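(* Let $(E,\mathcal P(E))$ be a measurable space and let $S(t)=(n(t),x(t))$ be a Markov jump process with state space $E$ driven by a set $\Xi$ of Poisson clocks as described in the context. Let $f:E\to\mathbb{R}^d$, for some $d\in\mathbb{N}$, be a measurable bounded function. For $j\in\mathbb{N}$ let $F_j(t)=\mathbb{E}[f(S(t))\mid n(t)=j]$ and $\pi_j(t)=P[n(t)=j]$. Suppose that for every $\epsilon\in\Xi$ there exist $A_\epsilon\in\mathbb{R}^{d\times d}$ and $b_\epsilon\in\mathbb{R}^d$ such that $$\mathbb{E}\left[f(S(t^+))\mid f(S(t)),\epsilon\right]=A_\epsilon f(S(t))+b_\epsilon,$$ where $S(t^+)$ denotes the state after an event of $\epsilon$ at time $t$. Then, for every $j\in\mathbb{N}$, $$\frac{d}{dt}\big(F_j(t)\pi_j(t)\big)=\sum_{\epsilon:\,a(\epsilon)=j}\lambda_\epsilon\,\pi_{s(\epsilon)}(t)\big(A_\epsilon F_{s(\epsilon)}(t)+b_\epsilon\big)-\sum_{\epsilon:\,s(\epsilon)=j}\lambda_\epsilon\,\pi_j(t)F_j(t).$$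
   Context: General model. The state is $S(t)=(n(t),x(t))$ with $n(t)\in\mathbb{N}$ (the system size, $0\in\mathbb N$) and $x(t)\in\mathbb{R}^{n(t)}$; $E$ is the set of such states, and $\mathcal P(E)$ is its $\sigma$-algebra of measurable sets. $S(t)$ is a (time-homogeneous) continuous-time Markov jump process, i.e. it evolves only by instantaneous changes ("jumps") at random times. To each value of the size is associated a finite set of independent Poisson clocks; $\Xi$ is the set of all clocks (over all values of the size). Each clock $\epsilon\in\Xi$ has a rate $\lambda_\epsilon\ge0$, a source size $s(\epsilon)\in\mathbb{N}$ and an arrival size $a(\epsilon)\in\mathbb{N}$: when the current size is $s(\epsilon)$, the clock $\epsilon$ activates with rate $\lambda_\epsilon$ (an "event of $\epsilon$"), and this triggers a jump which changes the size deterministically from $s(\epsilon)$ to $a(\epsilon)$ and modifies $x(t)$ randomly, according to a distribution depending on the values of $n(t)$ and $x(t)$ just before the event (and on $\epsilon$). Conditioning on $\epsilon$ means conditioning on an event of $\epsilon$ occurring at time $t$ (in particular $n(t)=s(\epsilon)$ just before it). When $\pi_j(t)=0$, the product $F_j(t)\pi_j(t)$ is understood as $\mathbb{E}[f(S(t))\mathbf 1_{\{n(t)=j\}}]=0$.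
   Formalization: Added: the series of λ_ε π_{s(ε)} over clocks with a(ε)=j converges uniformly near t (automatic if finitely many clocks arrive at j); otherwise the claim can fail, e.g. clocks k→0 of rate 4^k, P[n(0)=k]=2^-k, f=1, t=0. Jump times are assumed not to accumulate. *)

theory Defs
  imports "HOL-Probability.Probability"
begin

text \<open>
  A state is a pair \<open>(n, x)\<close> of a system size \<open>n\<close> and a vector \<open>x\<close> in \<open>\<real>\<^sup>n\<close>. Vectors in \<open>\<real>\<^sup>n\<close>
  are the functions that are extensional on \<open>{..<n}\<close>, with the Borel sets of \<open>\<real>\<^sup>n\<close> given by the
  product measure space. The state space is the disjoint union of the \<open>\<real>\<^sup>n\<close>.
\<close>

type_synonym state = "nat \<times> (nat \<Rightarrow> real)"

abbreviation size_of :: "state \<Rightarrow> nat" where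
  "size_of y \<equiv> fst y"

definition state_space :: "state measure" where
  "state_space = sigma (SIGMA n:UNIV. space (PiM {..<n} (\<lambda>_. borel :: real measure)))
     {{n} \<times> B |n B. B \<in> sets (PiM {..<n} (\<lambda>_. borel :: real measure))}"

text \<open>Waiting time for the next event of a Poisson clock; a clock of rate 0 never rings.\<close>

definition waiting_time :: "real \<Rightarrow> ereal measure" where
  "waiting_time r =
     (if r > 0 then distr (density lborel (exponential_density r)) borel ereal
      else return borel \<infinity>)"

text \<open>
  From state \<open>y\<close> the independent clocks whose source is the size of \<open>y\<close> run, and the first one to
  ring, \<open>\<epsilon>\<close>, replaces \<open>y\<close> by a random state with law \<open>K \<epsilon> y\<close>. The result is the law of the pair of
  holding time and new state. By memorylessness of the exponential law the clocks may be restarted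
  after each jump. If no clock ever rings (in particular if there is none, the infimum over the
  empty set being \<open>\<infinity>\<close>), then the holding time is \<open>\<infinity>\<close> and the second component is a dummy.
\<close>

definition next_jump ::
    "'c set \<Rightarrow> ('c \<Rightarrow> real) \<Rightarrow> ('c \<Rightarrow> nat) \<Rightarrow> ('c \<Rightarrow> state \<Rightarrow> state measure) \<Rightarrow>
     state \<Rightarrow> (ereal \<times> state) measure" where
  "next_jump \<Xi> rate src K y =
     (let C = {\<epsilon> \<in> \<Xi>. src \<epsilon> = size_of y} in
      PiM C (\<lambda>\<epsilon>. waiting_time (rate \<epsilon>)) \<bind> (\<lambda>w.
        let \<tau> = (INF \<epsilon>\<in>C. w \<epsilon>) in
        if \<tau> = \<infinity> then return (borel \<Otimes>\<^sub>M state_space) (\<infinity>, y)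
        else distr (K (arg_min_on w C) y) (borel \<Otimes>\<^sub>M state_space) (\<lambda>z. (\<tau>, z))))"

text \<open>
  The Markov jump process driven by the clocks, given by its jump times \<open>J m\<close> and the states \<open>Y m\<close>
  entered at these times: conditionally on the whole history up to the \<open>m\<close>-th jump, the next holding
  time and the next state have law \<open>next_jump\<close> at the present state. The initial law is arbitrary.
  The process is defined for all times, that is, the jump times do not accumulate. Its paths are
  right-continuous, so at an event of a clock at time \<open>t\<close>, \<open>S t\<close> is the state after the event.
  For a clock \<open>\<epsilon>\<close>, the kernel \<open>K \<epsilon>\<close> is only relevant on the states of size \<open>src \<epsilon>\<close>.
\<close>

locale clock_jump_process = prob_space M
  for M :: "'w measure"
    and \<Xi> :: "'c set"
    and rate :: "'c \<Rightarrow> real"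
    and src arr :: "'c \<Rightarrow> nat"
    and K :: "'c \<Rightarrow> state \<Rightarrow> state measure"
    and J :: "nat \<Rightarrow> 'w \<Rightarrow> ereal"
    and Y :: "nat \<Rightarrow> 'w \<Rightarrow> state"
    and S :: "real \<Rightarrow> 'w \<Rightarrow> state" +
  assumes finite_clocks: "\<And>n. finite {\<epsilon> \<in> \<Xi>. src \<epsilon> = n}"
    and rate_nonneg: "\<And>\<epsilon>. \<epsilon> \<in> \<Xi> \<Longrightarrow> 0 \<le> rate \<epsilon>"
    and kernel: "\<And>\<epsilon>. \<epsilon> \<in> \<Xi> \<Longrightarrow> K \<epsilon> \<in> state_space \<rightarrow>\<^sub>M prob_algebra state_space"
    and arrival: "\<And>\<epsilon> y. \<epsilon> \<in> \<Xi> \<Longrightarrow> y \<in> space state_space \<Longrightarrow> size_of y = src \<epsilon> \<Longrightarrow>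
      AE z in K \<epsilon> y. size_of z = arr \<epsilon>"
    and measurable_J: "\<And>m. J m \<in> M \<rightarrow>\<^sub>M borel"
    and measurable_Y: "\<And>m. Y m \<in> M \<rightarrow>\<^sub>M state_space"
    and measurable_S: "\<And>t. 0 \<le> t \<Longrightarrow> S t \<in> M \<rightarrow>\<^sub>M state_space"
    and initial_time: "AE \<omega> in M. J 0 \<omega> = 0"
    and jump_chain: "\<And>m.
      distr M (PiM {..Suc m} (\<lambda>_. borel \<Otimes>\<^sub>M state_space)) (\<lambda>\<omega>. \<lambda>i\<in>{..Suc m}. (J i \<omega>, Y i \<omega>)) =
      distr M (PiM {..m} (\<lambda>_. borel \<Otimes>\<^sub>M state_space)) (\<lambda>\<omega>. \<lambda>i\<in>{..m}. (J i \<omega>, Y i \<omega>)) \<bind>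
        (\<lambda>h. distr (next_jump \<Xi> rate src K (snd (h m)))
               (PiM {..Suc m} (\<lambda>_. borel \<Otimes>\<^sub>M state_space))
               (\<lambda>(\<tau>, z). h(Suc m := (fst (h m) + \<tau>, z))))"
    and path: "AE \<omega> in M. \<forall>t\<ge>0. \<forall>m. J m \<omega> \<le> ereal t \<and> ereal t < J (Suc m) \<omega> \<longrightarrow> S t \<omega> = Y m \<omega>"
    and no_explosion: "AE \<omega> in M. \<forall>t. \<exists>m. ereal t < J m \<omega>"

definition size_event :: "'w measure \<Rightarrow> (real \<Rightarrow> 'w \<Rightarrow> state) \<Rightarrow> nat \<Rightarrow> real \<Rightarrow> 'w set" where
  "size_event M S j t = {\<omega> \<in> space M. size_of (S t \<omega>) = j}"

definition size_prob :: "'w measure \<Rightarrow> (real \<Rightarrow> 'w \<Rightarrow> state) \<Rightarrow> nat \<Rightarrow> real \<Rightarrow> real" where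
  "size_prob M S j t = measure M (size_event M S j t)"

text \<open>
  \<open>uniform_measure M B\<close> is the conditional probability measure given \<open>B\<close>. If \<open>B\<close> has probability 0,
  the value of \<open>cond_mean\<close> is immaterial, as it is always multiplied by \<open>size_prob\<close>.
\<close>

definition cond_mean ::
    "'w measure \<Rightarrow> (real \<Rightarrow> 'w \<Rightarrow> state) \<Rightarrow> (state \<Rightarrow> 'b) \<Rightarrow> nat \<Rightarrow> real \<Rightarrow>
     'b::{banach, second_countable_topology}" where
  "cond_mean M S f j t = (\<integral>\<omega>. f (S t \<omega>) \<partial>uniform_measure M (size_event M S j t))"

text \<open>
  The joint law of the states just before and just after an event of \<open>\<epsilon>\<close> at time \<open>t\<close>. An event of
  \<open>\<epsilon>\<close> at a given time has probability 0, so conditioning on it is not elementary: the state before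
  the event has the law of the state at time \<open>t\<close> given that the size is \<open>src \<epsilon>\<close> (the clock is
  independent of the past, and almost surely there is no jump at the fixed time \<open>t\<close>), and the state
  after the event is drawn from \<open>K \<epsilon>\<close>.
\<close>

definition event_law ::
    "'w measure \<Rightarrow> (real \<Rightarrow> 'w \<Rightarrow> state) \<Rightarrow> ('c \<Rightarrow> nat) \<Rightarrow> ('c \<Rightarrow> state \<Rightarrow> state measure) \<Rightarrow>
     'c \<Rightarrow> real \<Rightarrow> (state \<times> state) measure" where
  "event_law M S src K \<epsilon> t =
     distr (uniform_measure M (size_event M S (src \<epsilon>) t)) state_space (S t) \<bind>
       (\<lambda>y. distr (K \<epsilon> y) (state_space \<Otimes>\<^sub>M state_space) (\<lambda>z. (y, z)))"

definition vec_cond_exp :: "'a measure \<Rightarrow> 'a measure \<Rightarrow> ('a \<Rightarrow> real^'d) \<Rightarrow> 'a \<Rightarrow> real^'d" where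
  "vec_cond_exp Q F g = (\<lambda>p. \<chi> i. real_cond_exp Q F (\<lambda>q. g q $ i) p)"

text \<open>
  \<open>E[f(S(t+)) | f(S(t)), \<epsilon>]\<close> as a function of the states before and after the event.
\<close>

definition event_cond_exp ::
    "'w measure \<Rightarrow> (real \<Rightarrow> 'w \<Rightarrow> state) \<Rightarrow> ('c \<Rightarrow> nat) \<Rightarrow> ('c \<Rightarrow> state \<Rightarrow> state measure) \<Rightarrow>
     (state \<Rightarrow> real^'d) \<Rightarrow> 'c \<Rightarrow> real \<Rightarrow> state \<times> state \<Rightarrow> real^'d" where
  "event_cond_exp M S src K f \<epsilon> t =
     vec_cond_exp (event_law M S src K \<epsilon> t)
       (vimage_algebra (space (event_law M S src K \<epsilon> t)) (\<lambda>(y, z). f y) borel)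
       (\<lambda>(y, z). f z)"

text \<open>
  The series of the jump intensities into size \<open>j\<close> converges uniformly near time \<open>t\<close>. Infinitely
  many clocks may arrive at \<open>j\<close>, and without such a condition the probability of size \<open>j\<close> need not be
  differentiable: take, for every \<open>k\<close>, one clock of rate \<open>4 ^ k\<close> from size \<open>k\<close> to size \<open>0\<close> and an
  initial size \<open>k \<ge> 1\<close> with probability \<open>1 / 2 ^ k\<close>, at \<open>t = 0\<close>.
\<close>

definition inflow_converges ::
    "'w measure \<Rightarrow> (real \<Rightarrow> 'w \<Rightarrow> state) \<Rightarrow> 'c set \<Rightarrow> ('c \<Rightarrow> real) \<Rightarrow> ('c \<Rightarrow> nat) \<Rightarrow> ('c \<Rightarrow> nat) \<Rightarrow>
     nat \<Rightarrow> real \<Rightarrow> bool" where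
  "inflow_converges M S \<Xi> rate src arr j t \<longleftrightarrow>
     (\<exists>\<delta>>0. \<exists>l. uniform_limit ({0..} \<inter> cball t \<delta>)
       (\<lambda>C r. \<Sum>\<epsilon>\<in>C. rate \<epsilon> * size_prob M S (src \<epsilon>) r) l
       (finite_subsets_at_top {\<epsilon> \<in> \<Xi>. arr \<epsilon> = j}))"

lemma inflow_converges_finite:
  assumes "finite {\<epsilon> \<in> \<Xi>. arr \<epsilon> = j}"
  shows "inflow_converges M S \<Xi> rate src arr j t"
  unfolding inflow_converges_def
  using assms
  by (intro exI[of _ 1] conjI
        exI[of _ "\<lambda>r. \<Sum>\<epsilon>\<in>{\<epsilon> \<in> \<Xi>. arr \<epsilon> = j}. rate \<epsilon> * size_prob M S (src \<epsilon>) r"])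
    (auto simp: finite_subsets_at_top_finite uniform_limit_iff eventually_principal)

end

theory Submission
  imports Defs
begin

text \<open>
  Let \<open>g \<ge> 0\<close> be a bounded function of the state that vanishes off size \<open>j\<close>. By the law of the first ring,
  for every \<open>m\<close> the expected value of \<open>\<phi> (Y m, Y (Suc m))\<close> on \<open>{J (Suc m) \<le> t}\<close> is the integral over
  \<open>s \<in> [0, t]\<close> of the jump intensity of \<open>\<phi>\<close> at \<open>Y m\<close> on \<open>{J m \<le> s < J (Suc m)}\<close>. With \<open>\<phi> (y, z) = g z\<close> this
  measures what enters size \<open>j\<close> at the next jump, with \<open>\<phi> (y, z) = g y\<close> what leaves. Summed over all \<open>m\<close>,
  since the jumps do not accumulate, it becomes an integral equation for \<open>E[g (S t)]\<close>. All terms are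
  nonnegative, so no interchange of sums needs a justification.

  The equation makes \<open>E[g (S t)]\<close> continuous in \<open>t\<close> for \<^emph>\<open>every\<close> such \<open>g\<close>, in particular for each summand of
  the inflow into \<open>j\<close>. Uniform convergence then makes the whole inflow continuous near \<open>t\<close>, and the
  fundamental theorem of calculus yields the derivative. The affine hypothesis identifies the
  summands.
\<close>

subsection \<open>Races of exponential clocks\<close>

text \<open>Rates may grow without bound over the sizes, so there is no bounded generator to work
  with, and the rate of inflow into size \<open>j\<close> may be unbounded as a function of the
  state. What stays bounded is the outflow, since only the single number \<open>total_rate j\<close>
  enters it. The integral equation thus controls the inflow a posteriori: its time integral is
  finite because outflow and present mass are. This suffices for continuity in time, but not for a
  derivative, as the integrand is not yet known to be continuous. A single clock does better:
  averaging \<open>g\<close> over its kernel gives a function of the state with the same bound that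
  lives on one size, the source of the clock, so the equation applies to this function in turn.

  Integrals stay in \<open>ennreal\<close> up to the integral equation. A signed \<open>f\<close>
  enters only at the end, where a constant is added to each component to make it
  nonnegative.\<close>

lemma prob_space_waiting_time: "prob_space (waiting_time r)"
proof (cases "r > 0")
  case True
  then interpret prob_space "density lborel (exponential_density r)"
    by (rule prob_space_exponential_density)
  show ?thesis
    using True by (auto simp: waiting_time_def intro!: prob_space_distr)
qed (simp add: waiting_time_def prob_space_return)

lemma sets_waiting_time [simp, measurable_cong]: "sets (waiting_time r) = sets borel"
  by (simp add: waiting_time_def)

lemma space_waiting_time [simp]: "space (waiting_time r) = UNIV"
  using sets_eq_imp_space_eq[OF sets_waiting_time] by simp

text \<open>The condition \<open>h \<infinity> = 0\<close> lets one formula cover both kinds of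
  clocks: at rate 0 all mass sits at \<open>\<infinity>\<close> and both sides vanish.\<close>

lemma nn_integral_waiting_time:
  assumes [measurable]: "h \<in> borel_measurable borel" and "h \<infinity> = 0" "0 \<le> r"
  shows "(\<integral>\<^sup>+x. h x \<partial>waiting_time r) =
    (\<integral>\<^sup>+s. ennreal (r * exp (- r * s)) * indicator {0..} s * h (ereal s) \<partial>lborel)"
proof (cases "r > 0")
  case True
  have "(\<integral>\<^sup>+x. h x \<partial>waiting_time r) =
      (\<integral>\<^sup>+s. ennreal (exponential_density r s) * h (ereal s) \<partial>lborel)"
    using True by (simp add: waiting_time_def nn_integral_distr nn_integral_density)
  also have "\<dots> = (\<integral>\<^sup>+s. ennreal (r * exp (- r * s)) * indicator {0..} s * h (ereal s) \<partial>lborel)"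
    by (intro nn_integral_cong) (auto simp: exponential_density_def mult.commute split: split_indicator)
  finally show ?thesis .
next
  case False
  with assms have "r = 0" by simp
  then show ?thesis
    using assms(2) by (simp add: waiting_time_def nn_integral_return)
qed

lemma emeasure_waiting_time_tail:
  assumes "0 \<le> r" "0 \<le> s"
  shows "emeasure (waiting_time r) {ereal s<..} = ennreal (exp (- r * s))"
proof (cases "r > 0")
  case True
  let ?D = "density lborel (exponential_density r)"
  interpret D: prob_space ?D
    using True by (rule prob_space_exponential_density)
  have "ereal -` {ereal s<..} \<inter> space ?D = space ?D - {..s}"
    by auto
  then have "emeasure (waiting_time r) {ereal s<..} = emeasure ?D (space ?D - {..s})"
    using True by (simp add: waiting_time_def emeasure_distr)
  also have "\<dots> = 1 - ennreal (erlang_CDF 0 r s)"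
    using D.emeasure_space_1 True
    by (subst emeasure_Diff) (auto simp: emeasure_erlang_density)
  also have "\<dots> = ennreal (exp (- r * s))"
    using assms True by (simp add: erlang_CDF_0 ennreal_minus ennreal_1[symmetric] del: ennreal_1)
  finally show ?thesis .
next
  case False
  with assms have "r = 0" by simp
  then show ?thesis
    by (simp add: waiting_time_def)
qed

text \<open>The law has a density, apart from a possible atom at \<open>\<infinity>\<close>. This
  excludes ties between a clock ringing at time \<open>s\<close> and the others.\<close>

lemma AE_waiting_time_neq:
  assumes "0 \<le> r"
  shows "AE x in waiting_time r. x \<noteq> ereal s"
proof -
  have "(\<integral>\<^sup>+x. indicator {ereal s} x \<partial>waiting_time r) =
      (\<integral>\<^sup>+u. ennreal (r * exp (- r * u)) * indicator {0..} u * indicator {ereal s} (ereal u) \<partial>lborel)"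
    using assms by (intro nn_integral_waiting_time) auto
  also have "\<dots> = (\<integral>\<^sup>+(u::real). 0 \<partial>lborel)"
    by (rule nn_integral_cong_AE, use AE_lborel_singleton[of s] in eventually_elim) auto
  finally have "emeasure (waiting_time r) {ereal s} = 0"
    by simp
  then show ?thesis
    by (intro AE_I[of _ _ "{ereal s}"]) auto
qed

text \<open>Strictness survives the infimum because a finite nonempty family attains it; over the
  empty set the infimum is \<open>\<infinity>\<close>, which exceeds every real.\<close>

lemma less_INF_finite_iff:
  fixes w :: "'c \<Rightarrow> ereal"
  assumes "finite C"
  shows "ereal s < (INF \<epsilon>\<in>C. w \<epsilon>) \<longleftrightarrow> (\<forall>\<epsilon>\<in>C. ereal s < w \<epsilon>)"
proof (cases "C = {}")
  case False
  then show ?thesis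
    using assms by (simp add: Min_Inf[symmetric])
qed (simp add: top_ereal_def)

lemma INF_eq_arg_min_on:
  fixes w :: "'c \<Rightarrow> ereal"
  assumes "finite C" "C \<noteq> {}"
  shows "(INF \<epsilon>\<in>C. w \<epsilon>) = w (arg_min_on w C)"
  using assms by (intro antisym INF_lower INF_greatest arg_min_if_finite(1) arg_min_least)

lemma arg_min_on_eqI:
  fixes w :: "'c \<Rightarrow> ereal"
  assumes "finite C" "e \<in> C" "\<And>i. i \<in> C \<Longrightarrow> i \<noteq> e \<Longrightarrow> w e < w i"
  shows "arg_min_on w C = e"
  using arg_min_if_finite[of C w] assms by (metis empty_iff)

lemma measurable_arg_min_on:
  fixes W :: "'c \<Rightarrow> ereal measure"
  assumes C: "finite C" "C \<noteq> {}" and W: "\<And>i. i \<in> C \<Longrightarrow> sets (W i) = sets borel"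
  shows "(\<lambda>w. arg_min_on w C) \<in> PiM C W \<rightarrow>\<^sub>M count_space C"
proof (rule measurable_count_space_eq2[THEN iffD2, OF C(1)], safe)
  fix w :: "'c \<Rightarrow> ereal" show "arg_min_on w C \<in> C" by (rule arg_min_if_finite(1)[OF C])
next
  fix e assume "e \<in> C"
  \<comment> \<open>Ties are resolved by choice, but the choice only depends on the set \<open>D w\<close> of minimisers.\<close>
  define D where "D w = {i\<in>C. \<forall>k\<in>C. w i \<le> w k}" for w :: "'c \<Rightarrow> ereal"
  have comp: "(\<lambda>w. w i) \<in> borel_measurable (PiM C W)" if "i \<in> C" for i
    using measurable_component_singleton[OF that, of W] W[OF that] measurable_cong_sets by blast
  have le: "{w \<in> space (PiM C W). w i \<le> w k} \<in> sets (PiM C W)" if "i \<in> C" "k \<in> C" for i k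
    by (intro borel_measurable_le comp that)
  define c where "c X = (SOME i. i \<in> X)" for X :: "'c set"
  have eq: "arg_min_on w C = c (D w)" for w
    by (auto simp: c_def arg_min_on_def arg_min_def is_arg_min_linorder D_def Ball_def)
  have D_sets: "{w \<in> space (PiM C W). D w = X} \<in> sets (PiM C W)" if "X \<subseteq> C" for X
  proof -
    have "{w \<in> space (PiM C W). D w = X} =
        {w \<in> space (PiM C W). \<forall>i\<in>C. (i \<in> X) = (\<forall>k\<in>C. w i \<le> w k)}"
      using that by (auto simp: D_def)
    also have "\<dots> \<in> sets (PiM C W)"
    proof (rule sets.sets_Collect_finite_All[OF _ C(1)])
      fix i assume "i \<in> C"
      then have "{w \<in> space (PiM C W). \<forall>k\<in>C. w i \<le> w k} \<in> sets (PiM C W)"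
        by (rule sets.sets_Collect_finite_All[OF le C(1)])
      then show "{w \<in> space (PiM C W). (i \<in> X) = (\<forall>k\<in>C. w i \<le> w k)} \<in> sets (PiM C W)"
        by (cases "i \<in> X") (auto dest: sets.sets_Collect_neg)
    qed
    finally show ?thesis .
  qed
  have "(\<lambda>w. arg_min_on w C) -` {e} \<inter> space (PiM C W) =
      (\<Union>X\<in>{X \<in> Pow C. c X = e}. {w \<in> space (PiM C W). D w = X})"
    unfolding eq by (auto simp: D_def)
  also have "\<dots> \<in> sets (PiM C W)"
    using C(1) D_sets by (intro sets.finite_UN) auto
  finally show "(\<lambda>w. arg_min_on w C) -` {e} \<inter> space (PiM C W) \<in> sets (PiM C W)" .
qed

text \<open>By independence the survival probabilities multiply, so the rates add. The event is
  written as a product of indicators because that is the form on which the product measure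
  factorises.\<close>

lemma nn_integral_no_ring:
  assumes C: "finite C" and rate: "\<And>\<epsilon>. \<epsilon> \<in> C \<Longrightarrow> 0 \<le> rate \<epsilon>" and s: "0 \<le> s"
  shows "(\<integral>\<^sup>+w. (\<Prod>\<epsilon>\<in>C. indicator {ereal s<..} (w \<epsilon>)) \<partial>PiM C (\<lambda>\<epsilon>. waiting_time (rate \<epsilon>))) =
    ennreal (exp (- (\<Sum>\<epsilon>\<in>C. rate \<epsilon>) * s))"
proof -
  interpret product_prob_space "\<lambda>\<epsilon>. waiting_time (rate \<epsilon>)"
    by (simp add: product_prob_space_def product_prob_space_axioms_def product_sigma_finite_def
        prob_space_waiting_time prob_space_imp_sigma_finite)
  show ?thesis
    using assms
    by (subst product_nn_integral_prod)
      (auto simp: emeasure_waiting_time_tail prod_ennreal exp_sum sum_distrib_right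
        simp flip: sum_negf)
qed

text \<open>If \<open>e\<close> rings at time \<open>s\<close>, it is the first exactly if every
  other clock survives \<open>s\<close>. Multiplying the density of \<open>e\<close> by these
  survival probabilities turns its own rate in the exponent into the total rate, while the prefactor
  remains \<open>rate e\<close>. The condition \<open>H \<infinity> = 0\<close> discards the event
  that nothing rings.\<close>

lemma nn_integral_first_ring:
  assumes C: "finite C" "e \<in> C" and rate: "\<And>\<epsilon>. \<epsilon> \<in> C \<Longrightarrow> 0 \<le> rate \<epsilon>"
    and H[measurable]: "H \<in> borel_measurable borel" and H_inf: "H \<infinity> = 0"
  shows "(\<integral>\<^sup>+w. indicator {e} (arg_min_on w C) * H (w e) \<partial>PiM C (\<lambda>\<epsilon>. waiting_time (rate \<epsilon>))) =
    (\<integral>\<^sup>+s. ennreal (rate e * exp (- (\<Sum>\<epsilon>\<in>C. rate \<epsilon>) * s)) * indicator {0..} s * H (ereal s) \<partial>lborel)"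
proof -
  let ?W = "\<lambda>\<epsilon>. waiting_time (rate \<epsilon>)"
  let ?f = "\<lambda>w. indicator {e} (arg_min_on w C) * H (w e)"
  define C' where "C' = C - {e}"
  have C': "finite C'" "e \<notin> C'" "C = insert e C'" using C by (auto simp: C'_def)
  interpret product_prob_space ?W
    by (simp add: product_prob_space_def product_prob_space_axioms_def product_sigma_finite_def
        prob_space_waiting_time prob_space_imp_sigma_finite)
  have am: "(\<lambda>w. arg_min_on w C) \<in> PiM C ?W \<rightarrow>\<^sub>M count_space C"
    using C by (intro measurable_arg_min_on) auto
  have [measurable]: "(\<lambda>w. w e) \<in> borel_measurable (PiM C ?W)"
    using measurable_component_singleton[OF C(2), of ?W]
    by (simp cong: measurable_cong_sets)
  have "(\<lambda>w. indicator {e} (arg_min_on w C) :: ennreal) \<in> borel_measurable (PiM C ?W)"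
    using am by (rule measurable_compose) auto
  then have f[measurable]: "?f \<in> borel_measurable (PiM C ?W)"
    by measurable
  \<comment> \<open>The ring of \<open>e\<close> is frozen at \<open>x\<close> and the other clocks
    are integrated out; Fubini later integrates \<open>g\<close> against the waiting time of
    \<open>e\<close>.\<close>
  define g where "g = (\<lambda>x. \<integral>\<^sup>+w. ?f (w(e := x)) \<partial>PiM C' ?W)"
  have g_eq: "g (ereal s) = ennreal (exp (- (\<Sum>\<epsilon>\<in>C'. rate \<epsilon>) * s)) * H (ereal s)" if "0 \<le> s" for s
  proof -
    have ind: "(\<lambda>w. indicator {ereal s<..} (w i) :: ennreal) \<in> borel_measurable (PiM C' ?W)"
      if "i \<in> C'" for i
      using measurable_compose[OF measurable_component_singleton[OF that, of ?W],
          of "indicator {ereal s<..} :: ereal \<Rightarrow> ennreal" borel]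
      by (simp cong: measurable_cong_sets)
    \<comment> \<open>If another clock also rings at \<open>s\<close>, \<open>arg_min_on\<close>
      makes an arbitrary choice. Such points are null, and off them strict comparison decides
      whether \<open>e\<close> wins.\<close>
    have "AE w in PiM C' ?W. \<forall>i\<in>C'. w i \<noteq> ereal s"
      using C' rate
      by (intro AE_finite_allI AE_PiM_component AE_waiting_time_neq prob_space_waiting_time) auto
    then have "g (ereal s) = (\<integral>\<^sup>+w. (\<Prod>\<epsilon>\<in>C'. indicator {ereal s<..} (w \<epsilon>)) * H (ereal s) \<partial>PiM C' ?W)"
      unfolding g_def
    proof (intro nn_integral_cong_AE, elim AE_mp, intro AE_I2 impI)
      fix w :: "'a \<Rightarrow> ereal" assume ne: "\<forall>i\<in>C'. w i \<noteq> ereal s"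
      let ?w = "w(e := ereal s)"
      show "?f ?w = (\<Prod>\<epsilon>\<in>C'. indicator {ereal s<..} (w \<epsilon>)) * H (ereal s)"
      proof (cases "\<forall>i\<in>C'. ereal s < w i")
        case True
        have "arg_min_on ?w C = e"
          using True C C' by (intro arg_min_on_eqI) auto
        with True show ?thesis by simp
      next
        case False
        then obtain i where i: "i \<in> C'" "w i < ereal s"
          using ne by force
        then have "?w i < ?w e" "i \<in> C" using C' by auto
        then have "arg_min_on ?w C \<noteq> e"
          using arg_min_if_finite(2)[OF C(1), of ?w] C(2) by (metis empty_iff)
        moreover have "(\<Prod>\<epsilon>\<in>C'. indicator {ereal s<..} (w \<epsilon>) :: ennreal) = 0"
          using i C' by (auto simp: prod_zero_iff intro!: bexI[of _ i])
        ultimately show ?thesis by simp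
      qed
    qed
    also have "\<dots> = (\<integral>\<^sup>+w. (\<Prod>\<epsilon>\<in>C'. indicator {ereal s<..} (w \<epsilon>)) \<partial>PiM C' ?W) * H (ereal s)"
      by (intro nn_integral_multc borel_measurable_prod_ennreal ind)
    finally show ?thesis
      using nn_integral_no_ring[of C' rate s] C' rate that by simp
  qed
  have g_inf: "g \<infinity> = 0" by (simp add: g_def H_inf)
  have g_meas: "g \<in> borel_measurable borel"
  proof -
    interpret P: sigma_finite_measure "PiM C' ?W"
      by (intro prob_space_imp_sigma_finite prob_space_PiM prob_space_waiting_time)
    have "(\<lambda>(x, w). w(e := x)) \<in> (borel :: ereal measure) \<Otimes>\<^sub>M PiM C' ?W \<rightarrow>\<^sub>M PiM C ?W"
      unfolding split_beta'
    proof (rule measurable_fun_upd[OF _ measurable_snd])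
      show "C = C' \<union> {e}" using C' by simp
      show "fst \<in> (borel :: ereal measure) \<Otimes>\<^sub>M PiM C' ?W \<rightarrow>\<^sub>M ?W e"
        using measurable_fst by (simp cong: measurable_cong_sets)
    qed
    then have "(\<lambda>(x, w). ?f (w(e := x))) \<in> borel_measurable ((borel :: ereal measure) \<Otimes>\<^sub>M PiM C' ?W)"
      using f unfolding split_beta' by (rule measurable_compose)
    then show ?thesis
      unfolding g_def by (rule P.borel_measurable_nn_integral)
  qed
  have "(\<integral>\<^sup>+w. ?f w \<partial>PiM C ?W) = (\<integral>\<^sup>+x. g x \<partial>?W e)"
    using f C' unfolding C'(3) g_def by (intro product_nn_integral_insert_rev) auto
  also have "\<dots> = (\<integral>\<^sup>+s. ennreal (rate e * exp (- rate e * s)) * indicator {0..} s * g (ereal s) \<partial>lborel)"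
    using rate C by (intro nn_integral_waiting_time g_meas g_inf) auto
  also have "\<dots> = (\<integral>\<^sup>+s. ennreal (rate e * exp (- (\<Sum>\<epsilon>\<in>C. rate \<epsilon>) * s)) * indicator {0..} s * H (ereal s) \<partial>lborel)"
  proof (rule nn_integral_cong)
    fix s :: real
    have "(\<Sum>\<epsilon>\<in>C. rate \<epsilon>) = rate e + (\<Sum>\<epsilon>\<in>C'. rate \<epsilon>)"
      unfolding C'(3) using C'(1,2) by simp
    then have "rate e * exp (- (\<Sum>\<epsilon>\<in>C. rate \<epsilon>) * s) =
        rate e * exp (- rate e * s) * exp (- (\<Sum>\<epsilon>\<in>C'. rate \<epsilon>) * s)"
      by (simp add: exp_add[symmetric] algebra_simps)
    then have "ennreal (rate e * exp (- (\<Sum>\<epsilon>\<in>C. rate \<epsilon>) * s)) =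
        ennreal (rate e * exp (- rate e * s)) * ennreal (exp (- (\<Sum>\<epsilon>\<in>C'. rate \<epsilon>) * s))"
      using rate[OF C(2)] by (simp only: ennreal_mult mult_nonneg_nonneg exp_ge_zero)
    then show "ennreal (rate e * exp (- rate e * s)) * indicator {0..} s * g (ereal s) =
        ennreal (rate e * exp (- (\<Sum>\<epsilon>\<in>C. rate \<epsilon>) * s)) * indicator {0..} s * H (ereal s)"
      by (cases "0 \<le> s") (simp_all add: g_eq mult.assoc)
  qed
  finally show ?thesis .
qed

subsection \<open>The law of the next jump\<close>

lemma space_state_space: "space state_space = (SIGMA n:UNIV. space (PiM {..<n} (\<lambda>_. borel)))"
  unfolding state_space_def
  by (rule space_measure_of) (auto dest: sets.sets_into_space)

lemma measurable_size_of: "size_of \<in> state_space \<rightarrow>\<^sub>M count_space UNIV"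
proof (subst measurable_count_space_eq2_countable, safe)
  fix n :: nat
  have "size_of -` {n} \<inter> space state_space = {n} \<times> space (PiM {..<n} (\<lambda>_. borel :: real measure))"
    by (auto simp: space_state_space)
  also have "\<dots> \<in> sets state_space"
    unfolding state_space_def
    by (rule in_measure_of) (auto dest: sets.sets_into_space)
  finally show "size_of -` {n} \<inter> space state_space \<in> sets state_space" .
qed auto

context clock_jump_process
begin

definition clocks :: "nat \<Rightarrow> 'c set" where
  "clocks n = {\<epsilon> \<in> \<Xi>. src \<epsilon> = n}"

definition total_rate :: "nat \<Rightarrow> real" where
  "total_rate n = (\<Sum>\<epsilon>\<in>clocks n. rate \<epsilon>)"

lemma clocksD: "\<epsilon> \<in> clocks n \<Longrightarrow> \<epsilon> \<in> \<Xi>" "\<epsilon> \<in> clocks n \<Longrightarrow> src \<epsilon> = n"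
  by (auto simp: clocks_def)

lemma finite_clocks' [simp]: "finite (clocks n)"
  unfolding clocks_def by (rule finite_clocks)

lemma total_rate_nonneg: "0 \<le> total_rate n"
  unfolding total_rate_def by (intro sum_nonneg rate_nonneg) (auto dest: clocksD)

lemma kernel_subprob: "\<epsilon> \<in> \<Xi> \<Longrightarrow> K \<epsilon> \<in> state_space \<rightarrow>\<^sub>M subprob_algebra state_space"
  by (intro measurable_prob_algebraD kernel)

lemma sets_kernel: "\<epsilon> \<in> \<Xi> \<Longrightarrow> y \<in> space state_space \<Longrightarrow> sets (K \<epsilon> y) = sets state_space"
  by (rule subprob_measurableD(2)[OF kernel_subprob])

lemma prob_space_kernel: "\<epsilon> \<in> \<Xi> \<Longrightarrow> y \<in> space state_space \<Longrightarrow> prob_space (K \<epsilon> y)"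
  using measurable_space[OF kernel] by (auto simp: space_prob_algebra)

abbreviation timed_states :: "(ereal \<times> state) measure" where
  "timed_states \<equiv> borel \<Otimes>\<^sub>M state_space"

text \<open>This is the integrand in \<open>next_jump\<close>, with the size \<open>n\<close> made a
  parameter separate from the state. For fixed \<open>n\<close> the space of ring times no longer
  depends on \<open>y\<close>, so joint measurability in \<open>y\<close> and \<open>w\<close> can
  be stated.\<close>

definition ring_kernel :: "nat \<Rightarrow> state \<Rightarrow> ('c \<Rightarrow> ereal) \<Rightarrow> (ereal \<times> state) measure" where
  "ring_kernel n y w =
     (if (INF \<epsilon>\<in>clocks n. w \<epsilon>) = \<infinity> then return timed_states (\<infinity>, y)
      else distr (K (arg_min_on w (clocks n)) y) timed_states (\<lambda>z. (INF \<epsilon>\<in>clocks n. w \<epsilon>, z)))"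

abbreviation rings :: "nat \<Rightarrow> ('c \<Rightarrow> ereal) measure" where
  "rings n \<equiv> PiM (clocks n) (\<lambda>\<epsilon>. waiting_time (rate \<epsilon>))"

lemma prob_space_rings: "prob_space (rings n)"
  by (intro prob_space_PiM prob_space_waiting_time)

lemma next_jump_eq:
  "next_jump \<Xi> rate src K y = rings (size_of y) \<bind> ring_kernel (size_of y) y"
  by (simp add: next_jump_def ring_kernel_def[abs_def] clocks_def Let_def cong: if_cong)

lemma measurable_ring_time: "(\<lambda>w. INF \<epsilon>\<in>clocks n. w \<epsilon>) \<in> borel_measurable (rings n)"
proof -
  have "(\<lambda>w. w \<epsilon>) \<in> borel_measurable (rings n)" if "\<epsilon> \<in> clocks n" for \<epsilon>
    using measurable_component_singleton[OF that, of "\<lambda>\<epsilon>. waiting_time (rate \<epsilon>)"]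
    by (simp cong: measurable_cong_sets)
  then show ?thesis
    by (intro borel_measurable_INF countable_finite finite_clocks')
qed

lemma measurable_ring_kernel:
  "(\<lambda>p. ring_kernel n (fst p) (snd p)) \<in> state_space \<Otimes>\<^sub>M rings n \<rightarrow>\<^sub>M subprob_algebra timed_states"
proof (cases "clocks n = {}")
  case True
  have "(\<lambda>p. return timed_states (\<infinity>, fst p)) \<in> state_space \<Otimes>\<^sub>M rings n \<rightarrow>\<^sub>M subprob_algebra timed_states"
    by (rule measurable_compose[OF _ return_measurable]) simp
  then show ?thesis
    by (simp add: ring_kernel_def True top_ereal_def)
next
  case False
  have [measurable]: "(\<lambda>p. INF \<epsilon>\<in>clocks n. snd p \<epsilon>) \<in> borel_measurable (state_space \<Otimes>\<^sub>M rings n)"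
    by (rule measurable_compose[OF measurable_snd measurable_ring_time])
  have "(\<lambda>p. arg_min_on (snd p) (clocks n)) \<in> state_space \<Otimes>\<^sub>M rings n \<rightarrow>\<^sub>M count_space (clocks n)"
    using False by (intro measurable_compose[OF measurable_snd measurable_arg_min_on]) auto
  \<comment> \<open>The index of the kernel is random but takes finitely many values, so
    measurability follows from that of each \<open>K e\<close>.\<close>
  then have [measurable]: "(\<lambda>p. K (arg_min_on (snd p) (clocks n)) (fst p))
      \<in> state_space \<Otimes>\<^sub>M rings n \<rightarrow>\<^sub>M subprob_algebra state_space"
    by (rule measurable_compose_countable'[rotated])
      (auto intro!: countable_finite measurable_compose[OF measurable_fst kernel_subprob] dest: clocksD)
  show ?thesis
    unfolding ring_kernel_def
  proof (intro measurable_If measurable_distr2)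
    show "(\<lambda>p. return timed_states (\<infinity>, fst p)) \<in> state_space \<Otimes>\<^sub>M rings n \<rightarrow>\<^sub>M subprob_algebra timed_states"
      by (rule measurable_compose[OF _ return_measurable]) simp
  qed measurable
qed

text \<open>The space \<open>rings n\<close> changes with the size. Measurability is therefore shown
  for fixed \<open>n\<close> and glued over the countably many sizes.\<close>

lemma measurable_next_jump:
  "next_jump \<Xi> rate src K \<in> state_space \<rightarrow>\<^sub>M subprob_algebra timed_states"
proof -
  have "(\<lambda>y. rings n \<bind> ring_kernel n y) \<in> state_space \<rightarrow>\<^sub>M subprob_algebra timed_states" for n
  proof (rule measurable_bind)
    show "(\<lambda>y. rings n) \<in> state_space \<rightarrow>\<^sub>M subprob_algebra (rings n)"
      using prob_space_imp_subprob_space[OF prob_space_rings]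
      by (intro measurable_const) (simp add: space_subprob_algebra)
  qed (rule measurable_ring_kernel)
  then show ?thesis
    unfolding next_jump_eq[abs_def]
    by (rule measurable_compose_countable[OF _ measurable_size_of])
qed

lemma nn_integral_next_jump_rings:
  assumes y: "y \<in> space state_space" and H[measurable]: "H \<in> borel_measurable timed_states"
  shows "(\<integral>\<^sup>+p. H p \<partial>next_jump \<Xi> rate src K y) =
    (\<integral>\<^sup>+w. (if (INF \<epsilon>\<in>clocks (size_of y). w \<epsilon>) = \<infinity> then H (\<infinity>, y)
       else \<integral>\<^sup>+z. H (INF \<epsilon>\<in>clocks (size_of y). w \<epsilon>, z) \<partial>K (arg_min_on w (clocks (size_of y))) y)
      \<partial>rings (size_of y))"
proof -
  let ?n = "size_of y"
  have "ring_kernel ?n y \<in> rings ?n \<rightarrow>\<^sub>M subprob_algebra timed_states"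
    using measurable_compose[OF measurable_Pair1'[OF y] measurable_ring_kernel] by simp
  then have "(\<integral>\<^sup>+p. H p \<partial>next_jump \<Xi> rate src K y) = (\<integral>\<^sup>+w. \<integral>\<^sup>+p. H p \<partial>ring_kernel ?n y w \<partial>rings ?n)"
    unfolding next_jump_eq by (rule nn_integral_bind[OF H])
  also have "\<dots> = (\<integral>\<^sup>+w. (if (INF \<epsilon>\<in>clocks ?n. w \<epsilon>) = \<infinity> then H (\<infinity>, y)
       else \<integral>\<^sup>+z. H (INF \<epsilon>\<in>clocks ?n. w \<epsilon>, z) \<partial>K (arg_min_on w (clocks ?n)) y) \<partial>rings ?n)"
  proof (intro nn_integral_cong)
    fix w
    show "(\<integral>\<^sup>+p. H p \<partial>ring_kernel ?n y w) = (if (INF \<epsilon>\<in>clocks ?n. w \<epsilon>) = \<infinity> then H (\<infinity>, y)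
       else \<integral>\<^sup>+z. H (INF \<epsilon>\<in>clocks ?n. w \<epsilon>, z) \<partial>K (arg_min_on w (clocks ?n)) y)"
    proof (cases "(INF \<epsilon>\<in>clocks ?n. w \<epsilon>) = \<infinity>")
      case True
      with y H show ?thesis
        by (simp add: ring_kernel_def nn_integral_return space_pair_measure)
    next
      case False
      then have "clocks ?n \<noteq> {}" by (auto simp: top_ereal_def)
      then have "arg_min_on w (clocks ?n) \<in> \<Xi>"
        using arg_min_if_finite(1)[of "clocks ?n" w] clocksD(1) by simp
      note [measurable_cong] = sets_kernel[OF this y]
      show ?thesis
        using False by (simp add: ring_kernel_def nn_integral_distr)
    qed
  qed
  finally show ?thesis .
qed

text \<open>The holding time and the new state are decoupled by splitting according to the clock
  that rings first; \<open>H_inf\<close> removes the case that none does.\<close>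

lemma nn_integral_next_jump:
  assumes y: "y \<in> space state_space" and H[measurable]: "H \<in> borel_measurable timed_states"
    and H_inf: "\<And>z. H (\<infinity>, z) = 0"
  shows "(\<integral>\<^sup>+p. H p \<partial>next_jump \<Xi> rate src K y) =
    (\<Sum>e\<in>clocks (size_of y). \<integral>\<^sup>+s. ennreal (rate e * exp (- total_rate (size_of y) * s)) *
      indicator {0..} s * (\<integral>\<^sup>+z. H (ereal s, z) \<partial>K e y) \<partial>lborel)"
proof -
  let ?C = "clocks (size_of y)"
  define H' where "H' e x = (\<integral>\<^sup>+z. H (x, z) \<partial>K e y)" for e x
  have H'_meas: "H' e \<in> borel_measurable borel" if "e \<in> ?C" for e
  proof -
    have e: "e \<in> \<Xi>" using that by (rule clocksD)
    interpret Ke: prob_space "K e y" by (rule prob_space_kernel[OF e y])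
    note [measurable_cong] = sets_kernel[OF e y]
    show ?thesis
      unfolding H'_def by measurable
  qed
  have H'_inf: "H' e \<infinity> = 0" for e by (simp add: H'_def H_inf)
  \<comment> \<open>Exactly one summand survives, that of the minimising clock. Each summand now
    involves a fixed kernel instead of one with a random index.\<close>
  have "(if (INF \<epsilon>\<in>?C. w \<epsilon>) = \<infinity> then H (\<infinity>, y)
       else \<integral>\<^sup>+z. H (INF \<epsilon>\<in>?C. w \<epsilon>, z) \<partial>K (arg_min_on w ?C) y) =
     (\<Sum>e\<in>?C. indicator {e} (arg_min_on w ?C) * H' e (w e))" for w
  proof (cases "?C = {}")
    case False
    then have am: "arg_min_on w ?C \<in> ?C" "(INF \<epsilon>\<in>?C. w \<epsilon>) = w (arg_min_on w ?C)"
      by (auto intro!: arg_min_if_finite(1) INF_eq_arg_min_on)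
    then have "(\<Sum>e\<in>?C. indicator {e} (arg_min_on w ?C) * H' e (w e)) =
        (\<Sum>e\<in>?C. if e = arg_min_on w ?C then H' e (w e) else 0)"
      by (intro sum.cong) auto
    then show ?thesis
      using am H'_inf by (simp add: H_inf H'_def)
  qed (simp add: top_ereal_def H_inf)
  then have "(\<integral>\<^sup>+p. H p \<partial>next_jump \<Xi> rate src K y) =
      (\<integral>\<^sup>+w. (\<Sum>e\<in>?C. indicator {e} (arg_min_on w ?C) * H' e (w e)) \<partial>rings (size_of y))"
    by (simp add: nn_integral_next_jump_rings[OF y H])
  also have "\<dots> = (\<Sum>e\<in>?C. \<integral>\<^sup>+w. indicator {e} (arg_min_on w ?C) * H' e (w e) \<partial>rings (size_of y))"
  proof (rule nn_integral_sum)
    fix e assume e: "e \<in> ?C"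
    have "(\<lambda>w. w e) \<in> borel_measurable (rings (size_of y))"
      using measurable_component_singleton[OF e, of "\<lambda>\<epsilon>. waiting_time (rate \<epsilon>)"]
      by (simp cong: measurable_cong_sets)
    then have "(\<lambda>w. H' e (w e)) \<in> borel_measurable (rings (size_of y))"
      using H'_meas[OF e] by (rule measurable_compose)
    moreover have "(\<lambda>w. indicator {e} (arg_min_on w ?C) :: ennreal) \<in> borel_measurable (rings (size_of y))"
      using e by (intro measurable_compose[OF measurable_arg_min_on]) auto
    ultimately show "(\<lambda>w. indicator {e} (arg_min_on w ?C) * H' e (w e)) \<in> borel_measurable (rings (size_of y))"
      by (intro borel_measurable_times_ennreal)
  qed
  also have "\<dots> = (\<Sum>e\<in>?C. \<integral>\<^sup>+s. ennreal (rate e * exp (- total_rate (size_of y) * s)) *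
      indicator {0..} s * H' e (ereal s) \<partial>lborel)"
    unfolding total_rate_def
    by (intro sum.cong nn_integral_first_ring H'_meas H'_inf rate_nonneg) (auto dest: clocksD)
  finally show ?thesis
    by (simp add: H'_def)
qed

text \<open>Here the holding time \<open>\<infinity>\<close> counts, so
  \<open>nn_integral_next_jump\<close> does not apply. The kernels contribute only their total mass
  1, and what is left is the event that no clock has rung by time \<open>s\<close>.\<close>

lemma nn_integral_next_jump_tail:
  assumes y: "y \<in> space state_space" and s: "0 \<le> s"
  shows "(\<integral>\<^sup>+p. indicator {ereal s<..} (fst p) \<partial>next_jump \<Xi> rate src K y) =
    ennreal (exp (- total_rate (size_of y) * s))"
proof -
  let ?C = "clocks (size_of y)"
  have "(\<integral>\<^sup>+p. indicator {ereal s<..} (fst p) \<partial>next_jump \<Xi> rate src K y) =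
      (\<integral>\<^sup>+w. (\<Prod>\<epsilon>\<in>?C. indicator {ereal s<..} (w \<epsilon>)) \<partial>rings (size_of y))"
  proof (subst nn_integral_next_jump_rings[OF y], goal_cases)
    case 2
    show ?case
    proof (intro nn_integral_cong)
      fix w :: "'c \<Rightarrow> ereal"
      have prod: "(\<Prod>\<epsilon>\<in>?C. indicator {ereal s<..} (w \<epsilon>)) =
          (indicator {ereal s<..} (INF \<epsilon>\<in>?C. w \<epsilon>) :: ennreal)"
        using less_INF_finite_iff[of ?C s w] by (auto simp: prod_zero_iff split: split_indicator)
      show "(if (INF \<epsilon>\<in>?C. w \<epsilon>) = \<infinity> then indicator {ereal s<..} (fst (\<infinity> :: ereal, y))
         else \<integral>\<^sup>+z. indicator {ereal s<..} (fst (INF \<epsilon>\<in>?C. w \<epsilon>, z)) \<partial>K (arg_min_on w ?C) y) =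
         (\<Prod>\<epsilon>\<in>?C. indicator {ereal s<..} (w \<epsilon>) :: ennreal)"
      proof (cases "(INF \<epsilon>\<in>?C. w \<epsilon>) = \<infinity>")
        case False
        then have "?C \<noteq> {}" by (auto simp: top_ereal_def)
        then have "arg_min_on w ?C \<in> \<Xi>"
          using arg_min_if_finite(1)[of ?C w] clocksD(1) by simp
        then interpret Ke: prob_space "K (arg_min_on w ?C) y"
          using y by (rule prob_space_kernel)
        show ?thesis
          using False by (simp add: prod Ke.emeasure_space_1)
      qed (simp add: prod)
    qed
  qed measurable
  also have "\<dots> = ennreal (exp (- total_rate (size_of y) * s))"
    unfolding total_rate_def using s
    by (intro nn_integral_no_ring rate_nonneg) (auto dest: clocksD)
  finally show ?thesis .
qed

subsection \<open>Transitions of the jump chain\<close>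

lemma sets_next_jump:
  "y \<in> space state_space \<Longrightarrow> sets (next_jump \<Xi> rate src K y) = sets timed_states"
  by (rule subprob_measurableD(2)[OF measurable_next_jump])

lemma Y_in_space: "\<omega> \<in> space M \<Longrightarrow> Y m \<omega> \<in> space state_space"
  by (rule measurable_space[OF measurable_Y])

text \<open>The integrand sees only the last two entries of the history, and the law of the new
  entry depends on the history only through the present one. All consequences of
  \<open>jump_chain\<close> pass through this Markov property.\<close>

lemma nn_integral_transition:
  assumes [measurable]: "\<Phi> \<in> borel_measurable (timed_states \<Otimes>\<^sub>M timed_states)"
  shows "(\<integral>\<^sup>+\<omega>. \<Phi> ((J m \<omega>, Y m \<omega>), (J (Suc m) \<omega>, Y (Suc m) \<omega>)) \<partial>M) =
    (\<integral>\<^sup>+\<omega>. \<integral>\<^sup>+p. \<Phi> ((J m \<omega>, Y m \<omega>), (J m \<omega> + fst p, snd p)) \<partial>next_jump \<Xi> rate src K (Y m \<omega>) \<partial>M)"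
proof -
  note [measurable] = measurable_J measurable_Y
  let ?P = "\<lambda>n. PiM {..n} (\<lambda>_. timed_states)"
  let ?h = "\<lambda>n \<omega>. \<lambda>i\<in>{..n}. (J i \<omega>, Y i \<omega>)"
  let ?k = "\<lambda>h. distr (next_jump \<Xi> rate src K (snd (h m))) (?P (Suc m))
               (\<lambda>(\<tau>, z). h(Suc m := (fst (h m) + \<tau>, z)))"
  let ?F = "\<lambda>h. \<Phi> (h m, h (Suc m))"
  have h_meas: "?h n \<in> M \<rightarrow>\<^sub>M ?P n" for n
    by (intro measurable_restrict) measurable
  have comp: "(\<lambda>h. h m) \<in> ?P m \<rightarrow>\<^sub>M timed_states"
    by (intro measurable_component_singleton) simp
  have F: "?F \<in> borel_measurable (?P (Suc m))"
  proof (rule measurable_compose[OF _ assms])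
    show "(\<lambda>h. (h m, h (Suc m))) \<in> ?P (Suc m) \<rightarrow>\<^sub>M timed_states \<Otimes>\<^sub>M timed_states"
      by (intro measurable_Pair measurable_component_singleton) auto
  qed
  have upd: "(\<lambda>p. (fst p)(Suc m := (fst (fst p m) + fst (snd p), snd (snd p))))
      \<in> ?P m \<Otimes>\<^sub>M timed_states \<rightarrow>\<^sub>M ?P (Suc m)"
  proof (rule measurable_fun_upd)
    show "{..Suc m} = {..m} \<union> {Suc m}" by auto
    have [measurable]: "(\<lambda>p. fst p m) \<in> ?P m \<Otimes>\<^sub>M timed_states \<rightarrow>\<^sub>M timed_states"
      by (rule measurable_compose[OF measurable_fst comp])
    show "(\<lambda>p. (fst (fst p m) + fst (snd p), snd (snd p))) \<in> ?P m \<Otimes>\<^sub>M timed_states \<rightarrow>\<^sub>M timed_states"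
      by measurable
  qed measurable
  have k_meas: "?k \<in> ?P m \<rightarrow>\<^sub>M subprob_algebra (?P (Suc m))"
  proof (rule measurable_distr2)
    show "(\<lambda>h. next_jump \<Xi> rate src K (snd (h m))) \<in> ?P m \<rightarrow>\<^sub>M subprob_algebra timed_states"
      by (rule measurable_compose[OF measurable_compose[OF comp measurable_snd] measurable_next_jump])
    show "case_prod (\<lambda>h (\<tau>, z). h(Suc m := (fst (h m) + \<tau>, z))) \<in> ?P m \<Otimes>\<^sub>M timed_states \<rightarrow>\<^sub>M ?P (Suc m)"
      using upd by (simp add: split_beta')
  qed
  have "(\<integral>\<^sup>+\<omega>. \<Phi> ((J m \<omega>, Y m \<omega>), (J (Suc m) \<omega>, Y (Suc m) \<omega>)) \<partial>M) =
      (\<integral>\<^sup>+h. ?F h \<partial>distr M (?P (Suc m)) (?h (Suc m)))"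
    using F by (simp add: nn_integral_distr[OF h_meas])
  also have "\<dots> = (\<integral>\<^sup>+h. \<integral>\<^sup>+h'. ?F h' \<partial>?k h \<partial>distr M (?P m) (?h m))"
    unfolding jump_chain
    by (rule nn_integral_bind[OF F]) (use k_meas in \<open>simp cong: measurable_cong_sets\<close>)
  also have "\<dots> = (\<integral>\<^sup>+\<omega>. \<integral>\<^sup>+h'. ?F h' \<partial>?k (?h m \<omega>) \<partial>M)"
    using measurable_compose[OF k_meas nn_integral_measurable_subprob_algebra[OF F]]
    by (intro nn_integral_distr[OF h_meas]) (simp only: measurable_distr_eq1)
  also have "\<dots> = (\<integral>\<^sup>+\<omega>. \<integral>\<^sup>+p. \<Phi> ((J m \<omega>, Y m \<omega>), (J m \<omega> + fst p, snd p))
      \<partial>next_jump \<Xi> rate src K (Y m \<omega>) \<partial>M)"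
  proof (rule nn_integral_cong)
    fix \<omega> assume \<omega>: "\<omega> \<in> space M"
    have "(\<lambda>p. (?h m \<omega>)(Suc m := (fst (?h m \<omega> m) + fst p, snd p))) \<in> timed_states \<rightarrow>\<^sub>M ?P (Suc m)"
      using measurable_compose[OF measurable_Pair1'[OF measurable_space[OF h_meas \<omega>]] upd]
      by simp
    then have "(\<lambda>(\<tau>, z). (?h m \<omega>)(Suc m := (fst (?h m \<omega> m) + \<tau>, z)))
        \<in> next_jump \<Xi> rate src K (snd (?h m \<omega> m)) \<rightarrow>\<^sub>M ?P (Suc m)"
      using sets_next_jump[OF Y_in_space[OF \<omega>]]
      by (simp add: split_beta' cong: measurable_cong_sets)
    then show "(\<integral>\<^sup>+h'. ?F h' \<partial>?k (?h m \<omega>)) = (\<integral>\<^sup>+p. \<Phi> ((J m \<omega>, Y m \<omega>), (J m \<omega> + fst p, snd p))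
        \<partial>next_jump \<Xi> rate src K (Y m \<omega>))"
      by (subst nn_integral_distr) (use F in \<open>auto simp: split_beta'\<close>)
  qed
  finally show ?thesis .
qed

text \<open>Monotone jump times are a consequence of the law of the holding times: the ring
  densities are supported on \<open>{0..}\<close>, so negative holding times have probability
  0.\<close>

lemma AE_J_le_Suc: "AE \<omega> in M. J m \<omega> \<le> J (Suc m) \<omega>"
proof -
  note [measurable] = measurable_J measurable_Y
  let ?\<Phi> = "\<lambda>q. indicator {q. fst (snd q) < fst (fst q)} q :: ennreal"
  have "(\<integral>\<^sup>+\<omega>. ?\<Phi> ((J m \<omega>, Y m \<omega>), (J (Suc m) \<omega>, Y (Suc m) \<omega>)) \<partial>M) =
    (\<integral>\<^sup>+\<omega>. \<integral>\<^sup>+p. ?\<Phi> ((J m \<omega>, Y m \<omega>), (J m \<omega> + fst p, snd p)) \<partial>next_jump \<Xi> rate src K (Y m \<omega>) \<partial>M)"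
    by (rule nn_integral_transition) measurable
  also have "\<dots> = (\<integral>\<^sup>+\<omega>. 0 \<partial>M)"
  proof (rule nn_integral_cong)
    fix \<omega> assume "\<omega> \<in> space M"
    then have y: "Y m \<omega> \<in> space state_space" by (rule Y_in_space)
    have "(\<integral>\<^sup>+p. ?\<Phi> ((J m \<omega>, Y m \<omega>), (J m \<omega> + fst p, snd p)) \<partial>next_jump \<Xi> rate src K (Y m \<omega>)) \<le>
        (\<integral>\<^sup>+p. indicator {..<0} (fst p) \<partial>next_jump \<Xi> rate src K (Y m \<omega>))"
    proof (intro nn_integral_mono)
      fix p :: "ereal \<times> state"
      show "?\<Phi> ((J m \<omega>, Y m \<omega>), (J m \<omega> + fst p, snd p)) \<le> indicator {..<0} (fst p)"
        using add_increasing2[of "fst p" "J m \<omega>" "J m \<omega>"]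
        by (auto simp: not_le[symmetric] split: split_indicator)
    qed
    also have "\<dots> = 0"
      by (subst nn_integral_next_jump[OF y]) (auto intro!: sum.neutral nn_integral_zero' AE_I2 split: split_indicator)
    finally show "(\<integral>\<^sup>+p. ?\<Phi> ((J m \<omega>, Y m \<omega>), (J m \<omega> + fst p, snd p)) \<partial>next_jump \<Xi> rate src K (Y m \<omega>)) = 0"
      by simp
  qed
  finally have "(\<integral>\<^sup>+\<omega>. ?\<Phi> ((J m \<omega>, Y m \<omega>), (J (Suc m) \<omega>, Y (Suc m) \<omega>)) \<partial>M) = 0"
    by simp
  then have "AE \<omega> in M. ?\<Phi> ((J m \<omega>, Y m \<omega>), (J (Suc m) \<omega>, Y (Suc m) \<omega>)) = 0"
    by (rule nn_integral_0_iff_AE[THEN iffD1, rotated]) measurable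
  then show ?thesis
    by eventually_elim (auto simp: not_le[symmetric] split: split_indicator_asm)
qed

lemma AE_mono_J: "AE \<omega> in M. mono (\<lambda>m. J m \<omega>)"
proof -
  have "AE \<omega> in M. \<forall>m. J m \<omega> \<le> J (Suc m) \<omega>"
    by (simp add: AE_all_countable AE_J_le_Suc)
  then show ?thesis
    by eventually_elim (simp add: mono_iff_le_Suc)
qed

lemma AE_J_nonneg: "AE \<omega> in M. 0 \<le> J m \<omega>"
  using AE_mono_J initial_time
proof eventually_elim
  case (elim \<omega>)
  from monoD[OF elim(1), of 0 m] elim(2) show ?case by simp
qed

section \<open>The compensator of the transitions up to a fixed time\<close>

definition intensity :: "(state \<times> state \<Rightarrow> ennreal) \<Rightarrow> state \<Rightarrow> ennreal" where
  "intensity \<phi> y = (\<Sum>e\<in>clocks (size_of y). ennreal (rate e) * (\<integral>\<^sup>+z. \<phi> (y, z) \<partial>K e y))"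

lemma measurable_intensity:
  assumes [measurable]: "\<phi> \<in> borel_measurable (state_space \<Otimes>\<^sub>M state_space)"
  shows "intensity \<phi> \<in> borel_measurable state_space"
proof -
  have "(\<lambda>y. \<Sum>e\<in>clocks n. ennreal (rate e) * (\<integral>\<^sup>+z. \<phi> (y, z) \<partial>K e y)) \<in> borel_measurable state_space" for n
  proof (intro borel_measurable_sum borel_measurable_times_ennreal borel_measurable_const)
    fix e assume "e \<in> clocks n"
    then have "K e \<in> state_space \<rightarrow>\<^sub>M subprob_algebra state_space"
      by (intro kernel_subprob) (rule clocksD)
    then show "(\<lambda>y. \<integral>\<^sup>+z. \<phi> (y, z) \<partial>K e y) \<in> borel_measurable state_space"
      by (rule nn_integral_measurable_subprob_algebra2[rotated]) simp
  qed
  then show ?thesis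
    unfolding intensity_def[abs_def]
    by (rule measurable_compose_countable[OF _ measurable_size_of])
qed

text \<open>Given the clock, the ring time and the state entered are independent, so the integral
  factorises. The rates go into \<open>intensity\<close>; what remains under the time integral is
  the survival function, not the density, of the holding time.\<close>

lemma nn_integral_jumps_before:
  assumes \<phi>[measurable]: "\<phi> \<in> borel_measurable (state_space \<Otimes>\<^sub>M state_space)"
  shows "(\<integral>\<^sup>+\<omega>. \<phi> (Y m \<omega>, Y (Suc m) \<omega>) * indicator {..ereal t} (J (Suc m) \<omega>) \<partial>M) =
    (\<integral>\<^sup>+\<omega>. intensity \<phi> (Y m \<omega>) * (\<integral>\<^sup>+s. ennreal (exp (- total_rate (size_of (Y m \<omega>)) * s)) *
      indicator {0..} s * indicator {..ereal t} (J m \<omega> + ereal s) \<partial>lborel) \<partial>M)"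
proof -
  let ?\<Phi> = "\<lambda>q. \<phi> (snd (fst q), snd (snd q)) * indicator {..ereal t} (fst (snd q)) :: ennreal"
  have "(\<integral>\<^sup>+\<omega>. ?\<Phi> ((J m \<omega>, Y m \<omega>), (J (Suc m) \<omega>, Y (Suc m) \<omega>)) \<partial>M) =
    (\<integral>\<^sup>+\<omega>. \<integral>\<^sup>+p. ?\<Phi> ((J m \<omega>, Y m \<omega>), (J m \<omega> + fst p, snd p)) \<partial>next_jump \<Xi> rate src K (Y m \<omega>) \<partial>M)"
    by (rule nn_integral_transition) measurable
  also have "\<dots> = (\<integral>\<^sup>+\<omega>. intensity \<phi> (Y m \<omega>) * (\<integral>\<^sup>+s. ennreal (exp (- total_rate (size_of (Y m \<omega>)) * s)) *
      indicator {0..} s * indicator {..ereal t} (J m \<omega> + ereal s) \<partial>lborel) \<partial>M)"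
  proof (rule nn_integral_cong)
    fix \<omega> assume "\<omega> \<in> space M"
    then have y[measurable]: "Y m \<omega> \<in> space state_space" by (rule Y_in_space)
    let ?y = "Y m \<omega>" and ?q = "total_rate (size_of (Y m \<omega>))"
    let ?I = "\<lambda>s. ennreal (exp (- ?q * s)) * indicator {0..} s * indicator {..ereal t} (J m \<omega> + ereal s)"
    have "(\<integral>\<^sup>+p. ?\<Phi> ((J m \<omega>, ?y), (J m \<omega> + fst p, snd p)) \<partial>next_jump \<Xi> rate src K ?y) =
      (\<Sum>e\<in>clocks (size_of ?y). \<integral>\<^sup>+s. ennreal (rate e * exp (- ?q * s)) * indicator {0..} s *
        (\<integral>\<^sup>+z. \<phi> (?y, z) * indicator {..ereal t} (J m \<omega> + ereal s) \<partial>K e ?y) \<partial>lborel)"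
      by (subst nn_integral_next_jump[OF y]) (simp_all, measurable)
    also have "\<dots> = (\<Sum>e\<in>clocks (size_of ?y).
        ennreal (rate e) * (\<integral>\<^sup>+z. \<phi> (?y, z) \<partial>K e ?y) * (\<integral>\<^sup>+s. ?I s \<partial>lborel))"
    proof (rule sum.cong)
      fix e assume "e \<in> clocks (size_of ?y)"
      then have e: "e \<in> \<Xi>" by (rule clocksD)
      note [measurable_cong] = sets_kernel[OF e y]
      have "(\<integral>\<^sup>+s. ennreal (rate e * exp (- ?q * s)) * indicator {0..} s *
          (\<integral>\<^sup>+z. \<phi> (?y, z) * indicator {..ereal t} (J m \<omega> + ereal s) \<partial>K e ?y) \<partial>lborel) =
        (\<integral>\<^sup>+s. ennreal (rate e) * (\<integral>\<^sup>+z. \<phi> (?y, z) \<partial>K e ?y) * ?I s \<partial>lborel)"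
        using rate_nonneg[OF e]
        by (intro nn_integral_cong) (simp add: nn_integral_multc ennreal_mult ac_simps)
      also have "\<dots> = ennreal (rate e) * (\<integral>\<^sup>+z. \<phi> (?y, z) \<partial>K e ?y) * (\<integral>\<^sup>+s. ?I s \<partial>lborel)"
        by (rule nn_integral_cmult) measurable
      finally show "(\<integral>\<^sup>+s. ennreal (rate e * exp (- ?q * s)) * indicator {0..} s *
          (\<integral>\<^sup>+z. \<phi> (?y, z) * indicator {..ereal t} (J m \<omega> + ereal s) \<partial>K e ?y) \<partial>lborel) =
        ennreal (rate e) * (\<integral>\<^sup>+z. \<phi> (?y, z) \<partial>K e ?y) * (\<integral>\<^sup>+s. ?I s \<partial>lborel)" .
    qed simp
    also have "\<dots> = intensity \<phi> ?y * (\<integral>\<^sup>+s. ?I s \<partial>lborel)"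
      by (simp add: intensity_def sum_distrib_right)
    finally show "(\<integral>\<^sup>+p. ?\<Phi> ((J m \<omega>, ?y), (J m \<omega> + fst p, snd p)) \<partial>next_jump \<Xi> rate src K ?y) =
      intensity \<phi> ?y * (\<integral>\<^sup>+s. ?I s \<partial>lborel)" .
  qed
  finally show ?thesis by simp
qed

text \<open>Given the history up to jump \<open>m\<close>, the process has not yet left at time
  \<open>s\<close> with an exponential survival probability in the elapsed time. The value of
  \<open>real_of_ereal\<close> matters only where the indicator is 1, and there \<open>J m\<close>
  is almost surely a nonnegative real.\<close>

lemma nn_integral_sojourn:
  assumes \<psi>[measurable]: "\<psi> \<in> borel_measurable state_space"
  shows "(\<integral>\<^sup>+\<omega>. \<psi> (Y m \<omega>) * indicator {J m \<omega> ..< J (Suc m) \<omega>} (ereal s) \<partial>M) =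
    (\<integral>\<^sup>+\<omega>. \<psi> (Y m \<omega>) * (indicator {J m \<omega>..} (ereal s) *
      ennreal (exp (- total_rate (size_of (Y m \<omega>)) * (s - real_of_ereal (J m \<omega>))))) \<partial>M)"
proof -
  let ?\<Phi> = "\<lambda>q. \<psi> (snd (fst q)) * (indicator {..ereal s} (fst (fst q)) *
    indicator {ereal s<..} (fst (snd q))) :: ennreal"
  have "(\<integral>\<^sup>+\<omega>. \<psi> (Y m \<omega>) * indicator {J m \<omega> ..< J (Suc m) \<omega>} (ereal s) \<partial>M) =
      (\<integral>\<^sup>+\<omega>. ?\<Phi> ((J m \<omega>, Y m \<omega>), (J (Suc m) \<omega>, Y (Suc m) \<omega>)) \<partial>M)"
    by (intro nn_integral_cong) (auto split: split_indicator)
  also have "\<dots> =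
    (\<integral>\<^sup>+\<omega>. \<integral>\<^sup>+p. ?\<Phi> ((J m \<omega>, Y m \<omega>), (J m \<omega> + fst p, snd p)) \<partial>next_jump \<Xi> rate src K (Y m \<omega>) \<partial>M)"
    by (rule nn_integral_transition) measurable
  also have "\<dots> = (\<integral>\<^sup>+\<omega>. \<psi> (Y m \<omega>) * (indicator {J m \<omega>..} (ereal s) *
      ennreal (exp (- total_rate (size_of (Y m \<omega>)) * (s - real_of_ereal (J m \<omega>))))) \<partial>M)"
  proof (rule nn_integral_cong_AE, use AE_J_nonneg[of m] AE_space in eventually_elim)
    case (elim \<omega>)
    then have y: "Y m \<omega> \<in> space state_space" by (intro Y_in_space)
    note [measurable_cong] = sets_next_jump[OF y]
    have "(\<integral>\<^sup>+p. ?\<Phi> ((J m \<omega>, Y m \<omega>), (J m \<omega> + fst p, snd p)) \<partial>next_jump \<Xi> rate src K (Y m \<omega>)) =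
      \<psi> (Y m \<omega>) * (indicator {J m \<omega>..} (ereal s) *
        (\<integral>\<^sup>+p. indicator {ereal s<..} (J m \<omega> + fst p) \<partial>next_jump \<Xi> rate src K (Y m \<omega>)))"
      by (simp add: nn_integral_cmult indicator_def)
    also have "\<dots> = \<psi> (Y m \<omega>) * (indicator {J m \<omega>..} (ereal s) *
      ennreal (exp (- total_rate (size_of (Y m \<omega>)) * (s - real_of_ereal (J m \<omega>)))))"
    proof (cases "J m \<omega> \<le> ereal s")
      case True
      then obtain r where r: "J m \<omega> = ereal r" "r \<le> s"
        using elim(1) by (cases "J m \<omega>") auto
      have "ereal s < ereal r + x \<longleftrightarrow> ereal (s - r) < x" for x
        by (cases x) auto
      then have "(\<integral>\<^sup>+p. indicator {ereal s<..} (J m \<omega> + fst p) \<partial>next_jump \<Xi> rate src K (Y m \<omega>)) =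
          (\<integral>\<^sup>+p. indicator {ereal (s - r)<..} (fst p) \<partial>next_jump \<Xi> rate src K (Y m \<omega>))"
        by (simp add: r indicator_def)
      also have "\<dots> = ennreal (exp (- total_rate (size_of (Y m \<omega>)) * (s - r)))"
        using r by (intro nn_integral_next_jump_tail y) simp
      finally show ?thesis by (simp add: r)
    qed simp
    finally show ?case .
  qed
  finally show ?thesis .
qed

text \<open>This changes absolute time into time since the jump at \<open>r\<close>. Because
  \<open>0 \<le> r\<close>, the lower end 0 of the interval imposes nothing beyond
  \<open>r \<le> s\<close>.\<close>

lemma nn_integral_shifted_exp:
  assumes "0 \<le> r"
  shows "(\<integral>\<^sup>+s. indicator {0..t} s * (indicator {ereal r..} (ereal s) * ennreal (exp (- q * (s - r)))) \<partial>lborel) =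
    (\<integral>\<^sup>+s. ennreal (exp (- q * s)) * indicator {0..} s * indicator {..ereal t} (ereal r + ereal s) \<partial>lborel)"
  by (subst nn_integral_real_affine[where c = 1 and t = r])
    (use assms in \<open>auto intro!: nn_integral_cong split: split_indicator\<close>)

text \<open>Conditionally on \<open>J m\<close> and \<open>Y m\<close>, both sides equal the
  intensity times the survival function integrated from the jump to \<open>t\<close>. On the left
  time runs from the jump, on the right it is absolute; Tonelli and a shift reconcile the
  two.\<close>

lemma nn_integral_jumps_eq_sojourns:
  assumes \<phi>[measurable]: "\<phi> \<in> borel_measurable (state_space \<Otimes>\<^sub>M state_space)"
  shows "(\<integral>\<^sup>+\<omega>. \<phi> (Y m \<omega>, Y (Suc m) \<omega>) * indicator {..ereal t} (J (Suc m) \<omega>) \<partial>M) =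
    (\<integral>\<^sup>+s. indicator {0..t} s *
      (\<integral>\<^sup>+\<omega>. intensity \<phi> (Y m \<omega>) * indicator {J m \<omega> ..< J (Suc m) \<omega>} (ereal s) \<partial>M) \<partial>lborel)"
proof -
  note [measurable] = measurable_J measurable_Y measurable_intensity[OF \<phi>]
  have q[measurable]: "(\<lambda>\<omega>. total_rate (size_of (Y m \<omega>))) \<in> borel_measurable M"
    by (rule measurable_compose[OF measurable_compose[OF measurable_Y measurable_size_of]]) simp
  interpret L: pair_sigma_finite lborel M
    by (intro pair_sigma_finite.intro) unfold_locales
  let ?g = "\<lambda>s \<omega>. indicator {0..t} s * (indicator {J m \<omega>..} (ereal s) *
      ennreal (exp (- total_rate (size_of (Y m \<omega>)) * (s - real_of_ereal (J m \<omega>)))))"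
  \<comment> \<open>The interval moves with the sample point, so joint measurability is obtained
    from the comparison of two measurable functions.\<close>
  have [measurable]: "(\<lambda>p. indicator {J m (snd p)..} (ereal (fst p)) :: ennreal) \<in> borel_measurable (lborel \<Otimes>\<^sub>M M)"
  proof -
    have "Measurable.pred (lborel \<Otimes>\<^sub>M M) (\<lambda>p. J m (snd p) \<le> ereal (fst p))"
      by measurable
    then show ?thesis
      by (simp add: indicator_def)
  qed
  have g: "(\<lambda>p. ?g (fst p) (snd p)) \<in> borel_measurable (lborel \<Otimes>\<^sub>M M)"
    by measurable
  have "(\<integral>\<^sup>+s. indicator {0..t} s *
      (\<integral>\<^sup>+\<omega>. intensity \<phi> (Y m \<omega>) * indicator {J m \<omega> ..< J (Suc m) \<omega>} (ereal s) \<partial>M) \<partial>lborel) =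
    (\<integral>\<^sup>+s. (\<integral>\<^sup>+\<omega>. intensity \<phi> (Y m \<omega>) * ?g s \<omega> \<partial>M) \<partial>lborel)"
  proof (intro nn_integral_cong)
    fix s :: real
    show "indicator {0..t} s *
      (\<integral>\<^sup>+\<omega>. intensity \<phi> (Y m \<omega>) * indicator {J m \<omega> ..< J (Suc m) \<omega>} (ereal s) \<partial>M) =
      (\<integral>\<^sup>+\<omega>. intensity \<phi> (Y m \<omega>) * ?g s \<omega> \<partial>M)"
      by (cases "s \<in> {0..t}") (simp_all add: nn_integral_sojourn measurable_intensity)
  qed
  also have "\<dots> = (\<integral>\<^sup>+\<omega>. (\<integral>\<^sup>+s. intensity \<phi> (Y m \<omega>) * ?g s \<omega> \<partial>lborel) \<partial>M)"
    using g by (intro L.Fubini'[symmetric]) (simp add: split_beta')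
  also have "\<dots> = (\<integral>\<^sup>+\<omega>. intensity \<phi> (Y m \<omega>) * (\<integral>\<^sup>+s. ennreal (exp (- total_rate (size_of (Y m \<omega>)) * s)) *
      indicator {0..} s * indicator {..ereal t} (J m \<omega> + ereal s) \<partial>lborel) \<partial>M)"
  proof (rule nn_integral_cong_AE, use AE_J_nonneg[of m] AE_space in eventually_elim)
    case (elim \<omega>)
    have "(\<lambda>s. ?g s \<omega>) \<in> borel_measurable lborel"
      using measurable_compose[OF measurable_Pair2'[OF elim(2)] g] by simp
    then have "(\<integral>\<^sup>+s. intensity \<phi> (Y m \<omega>) * ?g s \<omega> \<partial>lborel) = intensity \<phi> (Y m \<omega>) * (\<integral>\<^sup>+s. ?g s \<omega> \<partial>lborel)"
      by (rule nn_integral_cmult)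
    also have "(\<integral>\<^sup>+s. ?g s \<omega> \<partial>lborel) = (\<integral>\<^sup>+s. ennreal (exp (- total_rate (size_of (Y m \<omega>)) * s)) *
      indicator {0..} s * indicator {..ereal t} (J m \<omega> + ereal s) \<partial>lborel)"
    proof (cases "J m \<omega>")
      case (real r)
      with elim(1) show ?thesis
        using nn_integral_shifted_exp[of r t "total_rate (size_of (Y m \<omega>))"] by simp
    next
      case PInf
      then show ?thesis by simp
    next
      case MInf
      with elim(1) show ?thesis by simp
    qed
    finally show ?case .
  qed
  also have "\<dots> = (\<integral>\<^sup>+\<omega>. \<phi> (Y m \<omega>, Y (Suc m) \<omega>) * indicator {..ereal t} (J (Suc m) \<omega>) \<partial>M)"
    by (rule nn_integral_jumps_before[OF \<phi>, symmetric])
  finally show ?thesis by simp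
qed

end

subsection \<open>The integral equation\<close>

lemma nn_integral_count_space_infsum:
  fixes f :: "'a \<Rightarrow> real"
  assumes "f summable_on A" "\<And>x. x \<in> A \<Longrightarrow> 0 \<le> f x"
  shows "(\<integral>\<^sup>+x. ennreal (f x) \<partial>count_space A) = ennreal (\<Sum>\<^sub>\<infinity>x\<in>A. f x)"
proof -
  have "Infinite_Set_Sum.abs_summable_on f A"
    using assms(1) summable_on_iff_abs_summable_on_real[of f A] abs_summable_equivalent[of f A] by (simp only:)
  then show ?thesis
    using assms(2) by (simp add: nn_integral_conv_infsetsum infsetsum_infsum)
qed

text \<open>A finite integral forces \<open>F\<close> to be finite almost everywhere on the
  interval, so the value 0 that \<open>enn2real\<close> assigns to \<open>\<infinity>\<close> does
  no harm. The gauge integral is the one to which the fundamental theorem of calculus will be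
  applied.\<close>

lemma nn_integral_Icc_has_integral:
  fixes F :: "real \<Rightarrow> ennreal"
  assumes F: "(\<lambda>s. indicator {0..t} s * F s) \<in> borel_measurable borel"
    and fin: "(\<integral>\<^sup>+s. indicator {0..t} s * F s \<partial>lborel) < \<infinity>"
  shows "((\<lambda>s. enn2real (F s)) has_integral enn2real (\<integral>\<^sup>+s. indicator {0..t} s * F s \<partial>lborel)) {0..t}"
proof -
  let ?G = "\<lambda>s. indicator {0..t} s * F s"
  have "((\<lambda>s. enn2real (?G s)) has_integral enn2real (\<integral>\<^sup>+s. ?G s \<partial>lborel)) UNIV"
  proof (rule nn_integral_has_integral)
    show "(\<lambda>s. enn2real (?G s)) \<in> borel_measurable borel"
      using F by measurable
    have "AE s in lborel. ?G s \<noteq> \<infinity>"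
      using fin F by (intro nn_integral_PInf_AE) auto
    then have "(\<integral>\<^sup>+s. ennreal (enn2real (?G s)) \<partial>lborel) = (\<integral>\<^sup>+s. ?G s \<partial>lborel)"
      by (intro nn_integral_cong_AE) (auto elim!: eventually_mono simp: less_top[symmetric])
    also have "\<dots> = ennreal (enn2real (\<integral>\<^sup>+s. ?G s \<partial>lborel))"
      using fin by (simp add: less_top[symmetric])
    finally show "(\<integral>\<^sup>+s. ennreal (enn2real (?G s)) \<partial>lborel) = ennreal (enn2real (\<integral>\<^sup>+s. ?G s \<partial>lborel))" .
  qed auto
  also have "(\<lambda>s. enn2real (?G s)) = (\<lambda>s. if s \<in> {0..t} then enn2real (F s) else 0)"
    by (auto simp: fun_eq_iff)
  finally show ?thesis
    by (simp only: has_integral_restrict_UNIV)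
qed

section \<open>Expectations at a fixed time as sums over the sojourns\<close>

context clock_jump_process
begin

definition mean :: "(state \<Rightarrow> ennreal) \<Rightarrow> real \<Rightarrow> ennreal" where
  "mean h s = (\<integral>\<^sup>+\<omega>. h (S s \<omega>) \<partial>M)"

lemma sojourn_unique:
  assumes "mono (\<lambda>m. J m \<omega>)" "J k \<omega> \<le> s" "s < J (Suc k) \<omega>"
  shows "J m \<omega> \<le> s \<and> s < J (Suc m) \<omega> \<longleftrightarrow> m = k"
proof
  assume m: "J m \<omega> \<le> s \<and> s < J (Suc m) \<omega>"
  have "\<not> Suc m \<le> k"
    using monoD[OF assms(1), of "Suc m" k] m assms(2) by (meson leD order_trans)
  moreover have "\<not> Suc k \<le> m"
    using monoD[OF assms(1), of "Suc k" m] m assms(3) by (meson leD order_trans)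
  ultimately show "m = k" by simp
qed (use assms in simp)

lemma AE_sojourn:
  assumes "0 \<le> s"
  shows "AE \<omega> in M. \<exists>k. S s \<omega> = Y k \<omega> \<and>
    (\<forall>m. J m \<omega> \<le> ereal s \<and> ereal s < J (Suc m) \<omega> \<longleftrightarrow> m = k)"
  using AE_mono_J path no_explosion initial_time
proof eventually_elim
  case (elim \<omega>)
  \<comment> \<open>The first jump after \<open>s\<close> exists because the jumps do not
    accumulate. It is not jump 0, which happens at time 0, so it has a predecessor \<open>k\<close>,
    and \<open>s\<close> lies in the sojourn of \<open>k\<close>.\<close>
  define n where "n = (LEAST n. ereal s < J n \<omega>)"
  have n: "ereal s < J n \<omega>"
    unfolding n_def using elim(3) by (metis LeastI)
  have "n \<noteq> 0"
    using n elim(4) assms by (cases n) auto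
  then obtain k where k: "n = Suc k"
    using not0_implies_Suc by blast
  then have "J k \<omega> \<le> ereal s"
    using not_less_Least[of k "\<lambda>n. ereal s < J n \<omega>"] by (simp add: n_def not_less)
  with n k elim(1,2) assms show ?case
    by (intro exI[of _ k]) (auto simp: sojourn_unique)
qed

text \<open>Almost surely one sojourn contains \<open>s\<close>, so the series has a single nonzero
  term. Without \<open>no_explosion\<close> the left side would lose the mass of the paths that have
  exploded by time \<open>s\<close>.\<close>

lemma suminf_sojourns:
  assumes \<psi>[measurable]: "\<psi> \<in> borel_measurable state_space" and s: "0 \<le> s"
  shows "(\<Sum>m. \<integral>\<^sup>+\<omega>. \<psi> (Y m \<omega>) * indicator {J m \<omega> ..< J (Suc m) \<omega>} (ereal s) \<partial>M) = mean \<psi> s"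
proof -
  note [measurable] = measurable_J measurable_Y
  have ind: "(\<lambda>\<omega>. indicator {J m \<omega> ..< J (Suc m) \<omega>} (ereal s) :: ennreal) \<in> borel_measurable M" for m
  proof -
    have "(\<lambda>\<omega>. indicator {\<omega>. J m \<omega> \<le> ereal s \<and> ereal s < J (Suc m) \<omega>} \<omega> :: ennreal) \<in> borel_measurable M"
      by measurable
    then show ?thesis by (simp add: indicator_def)
  qed
  have "(\<Sum>m. \<integral>\<^sup>+\<omega>. \<psi> (Y m \<omega>) * indicator {J m \<omega> ..< J (Suc m) \<omega>} (ereal s) \<partial>M) =
      (\<integral>\<^sup>+\<omega>. (\<Sum>m. \<psi> (Y m \<omega>) * indicator {J m \<omega> ..< J (Suc m) \<omega>} (ereal s)) \<partial>M)"
    by (rule nn_integral_suminf[symmetric]) (intro borel_measurable_times_ennreal ind, measurable)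
  also have "\<dots> = mean \<psi> s"
    unfolding mean_def
  proof (rule nn_integral_cong_AE, use AE_sojourn[OF s] in eventually_elim)
    case (elim \<omega>)
    then obtain k where k: "S s \<omega> = Y k \<omega>"
      "\<And>m. J m \<omega> \<le> ereal s \<and> ereal s < J (Suc m) \<omega> \<longleftrightarrow> m = k"
      by blast
    have "(\<lambda>m. \<psi> (Y m \<omega>) * indicator {J m \<omega> ..< J (Suc m) \<omega>} (ereal s)) =
        (\<lambda>m. if m = k then \<psi> (Y m \<omega>) else 0)"
      by (auto simp: fun_eq_iff k(2) indicator_def)
    then show ?case
      using sums_unique[OF sums_single[of k "\<lambda>m. \<psi> (Y m \<omega>)"]] by (simp add: k(1))
  qed
  finally show ?thesis .
qed

lemma measurable_sojourn_prob:
  assumes \<psi>[measurable]: "\<psi> \<in> borel_measurable state_space"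
  shows "(\<lambda>s. \<integral>\<^sup>+\<omega>. \<psi> (Y m \<omega>) * indicator {J m \<omega> ..< J (Suc m) \<omega>} (ereal s) \<partial>M) \<in> borel_measurable borel"
proof -
  note [measurable] = measurable_J measurable_Y
  have "(\<lambda>p. indicator {p. J m (snd p) \<le> ereal (fst p) \<and> ereal (fst p) < J (Suc m) (snd p)} p :: ennreal)
      \<in> borel_measurable (borel \<Otimes>\<^sub>M M)"
    by measurable
  then have [measurable]: "(\<lambda>p. indicator {J m (snd p) ..< J (Suc m) (snd p)} (ereal (fst p)) :: ennreal)
      \<in> borel_measurable (borel \<Otimes>\<^sub>M M)"
    by (simp add: indicator_def)
  show ?thesis
    by (rule borel_measurable_nn_integral) (simp add: split_beta')
qed

text \<open>The process is only known to be measurable at each fixed time, which says nothing about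
  dependence on \<open>s\<close>. That comes from the series over the sojourns, whose terms are
  explicit in the jump times. The indicator keeps negative times out, where \<open>S\<close> is
  unconstrained.\<close>

lemma measurable_mean:
  assumes "\<psi> \<in> borel_measurable state_space"
  shows "(\<lambda>s. indicator {0..t} s * mean \<psi> s) \<in> borel_measurable borel"
proof -
  have "(\<lambda>s. indicator {0..t} s * mean \<psi> s) = (\<lambda>s. indicator {0..t} s *
      (\<Sum>m. \<integral>\<^sup>+\<omega>. \<psi> (Y m \<omega>) * indicator {J m \<omega> ..< J (Suc m) \<omega>} (ereal s) \<partial>M))"
    using assms by (auto simp: fun_eq_iff suminf_sojourns split: split_indicator)
  then show ?thesis
    using measurable_sojourn_prob[OF assms] by simp
qed

lemma nn_integral_mean:
  assumes \<psi>: "\<psi> \<in> borel_measurable state_space"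
  shows "(\<Sum>m. \<integral>\<^sup>+s. indicator {0..t} s *
      (\<integral>\<^sup>+\<omega>. \<psi> (Y m \<omega>) * indicator {J m \<omega> ..< J (Suc m) \<omega>} (ereal s) \<partial>M) \<partial>lborel) =
    (\<integral>\<^sup>+s. indicator {0..t} s * mean \<psi> s \<partial>lborel)"
proof -
  have "(\<Sum>m. \<integral>\<^sup>+s. indicator {0..t} s *
      (\<integral>\<^sup>+\<omega>. \<psi> (Y m \<omega>) * indicator {J m \<omega> ..< J (Suc m) \<omega>} (ereal s) \<partial>M) \<partial>lborel) =
    (\<integral>\<^sup>+s. (\<Sum>m. indicator {0..t} s *
      (\<integral>\<^sup>+\<omega>. \<psi> (Y m \<omega>) * indicator {J m \<omega> ..< J (Suc m) \<omega>} (ereal s) \<partial>M)) \<partial>lborel)"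
    using measurable_sojourn_prob[OF \<psi>]
    by (intro nn_integral_suminf[symmetric] borel_measurable_times_ennreal) auto
  also have "\<dots> = (\<integral>\<^sup>+s. indicator {0..t} s * mean \<psi> s \<partial>lborel)"
    by (intro nn_integral_cong) (auto simp: suminf_sojourns[OF \<psi>] split: split_indicator)
  finally show ?thesis .
qed

section \<open>Balance between what enters and what leaves one size\<close>

definition outflow_rate :: "(state \<Rightarrow> ennreal) \<Rightarrow> state \<Rightarrow> ennreal" where
  "outflow_rate g = intensity (\<lambda>p. g (fst p))"

definition inflow_rate :: "(state \<Rightarrow> ennreal) \<Rightarrow> state \<Rightarrow> ennreal" where
  "inflow_rate g = intensity (\<lambda>p. g (snd p))"

lemma measurable_inflow_rate:
  "g \<in> borel_measurable state_space \<Longrightarrow> inflow_rate g \<in> borel_measurable state_space"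
  unfolding inflow_rate_def
  by (intro measurable_intensity measurable_compose[OF measurable_snd])

lemma outflow_rate_eq:
  assumes y: "y \<in> space state_space"
  shows "outflow_rate g y = ennreal (total_rate (size_of y)) * g y"
proof -
  have "outflow_rate g y = (\<Sum>e\<in>clocks (size_of y). ennreal (rate e) * g y)"
    unfolding outflow_rate_def intensity_def
  proof (rule sum.cong)
    fix e assume "e \<in> clocks (size_of y)"
    then interpret Ke: prob_space "K e y"
      by (intro prob_space_kernel[OF clocksD(1) y])
    show "ennreal (rate e) * (\<integral>\<^sup>+z. g (fst (y, z)) \<partial>K e y) = ennreal (rate e) * g y"
      by (simp add: Ke.emeasure_space_1)
  qed simp
  also have "\<dots> = ennreal (total_rate (size_of y)) * g y"
    unfolding sum_distrib_right[symmetric] total_rate_def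
    by (subst sum_ennreal) (auto intro: rate_nonneg dest: clocksD)
  finally show ?thesis .
qed

text \<open>
  The mass of \<open>g\<close> at the states entered up to time \<open>t\<close> is counted once at entry and once at exit.
\<close>

lemma balance:
  assumes g[measurable]: "g \<in> borel_measurable state_space"
    and supp: "\<And>y. size_of y \<noteq> j \<Longrightarrow> g y = 0" and t: "0 \<le> t"
  shows "(\<integral>\<^sup>+\<omega>. g (Y 0 \<omega>) \<partial>M) + (\<integral>\<^sup>+s. indicator {0..t} s * mean (inflow_rate g) s \<partial>lborel) =
    ennreal (total_rate j) * (\<integral>\<^sup>+s. indicator {0..t} s * mean g s \<partial>lborel) + mean g t"
proof -
  note [measurable] = measurable_J measurable_Y
  \<comment> \<open>The mass \<open>a m\<close> of the state entered at jump \<open>m\<close> splits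
    into \<open>out m\<close>, left again by time \<open>t\<close>, and \<open>stay m\<close>, still
    occupied at \<open>t\<close>. Term 0 of \<open>a\<close> is the initial state, the later terms
    are the inflow.\<close>
  define a where "a m = (\<integral>\<^sup>+\<omega>. g (Y m \<omega>) * indicator {..ereal t} (J m \<omega>) \<partial>M)" for m
  define out where "out m = (\<integral>\<^sup>+\<omega>. g (Y m \<omega>) * indicator {..ereal t} (J (Suc m) \<omega>) \<partial>M)" for m
  define stay where
    "stay m = (\<integral>\<^sup>+\<omega>. g (Y m \<omega>) * indicator {J m \<omega> ..< J (Suc m) \<omega>} (ereal t) \<partial>M)" for m
  have split: "a m = out m + stay m" for m
  proof -
    have "(\<lambda>\<omega>. indicator {\<omega>. J m \<omega> \<le> ereal t \<and> ereal t < J (Suc m) \<omega>} \<omega> :: ennreal) \<in> borel_measurable M"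
      by measurable
    then have [measurable]: "(\<lambda>\<omega>. indicator {J m \<omega> ..< J (Suc m) \<omega>} (ereal t) :: ennreal) \<in> borel_measurable M"
      by (simp add: indicator_def)
    have "a m = (\<integral>\<^sup>+\<omega>. g (Y m \<omega>) * indicator {..ereal t} (J (Suc m) \<omega>) +
        g (Y m \<omega>) * indicator {J m \<omega> ..< J (Suc m) \<omega>} (ereal t) \<partial>M)"
      unfolding a_def
      by (rule nn_integral_cong_AE, use AE_J_le_Suc[of m] in eventually_elim)
        (auto split: split_indicator)
    then show ?thesis
      unfolding out_def stay_def by (simp add: nn_integral_add)
  qed
  have a_0: "a 0 = (\<integral>\<^sup>+\<omega>. g (Y 0 \<omega>) \<partial>M)"
    unfolding a_def
    by (rule nn_integral_cong_AE, use initial_time in eventually_elim) (use t in auto)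
  \<comment> \<open>Weighting a transition by \<open>g\<close> of the state it enters turns the mass
    at entry \<open>Suc m\<close> into the inflow collected during sojourn \<open>m\<close>.\<close>
  have a_Suc: "a (Suc m) = (\<integral>\<^sup>+s. indicator {0..t} s *
      (\<integral>\<^sup>+\<omega>. inflow_rate g (Y m \<omega>) * indicator {J m \<omega> ..< J (Suc m) \<omega>} (ereal s) \<partial>M) \<partial>lborel)" for m
    unfolding a_def inflow_rate_def
    using nn_integral_jumps_eq_sojourns[of "\<lambda>p. g (snd p)" m t] by simp
  \<comment> \<open>Since \<open>g\<close> vanishes off size \<open>j\<close>, the rate depending on
    the size may be replaced by a constant.\<close>
  have outflow: "outflow_rate g (Y m \<omega>) = ennreal (total_rate j) * g (Y m \<omega>)" if "\<omega> \<in> space M" for m \<omega>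
    using outflow_rate_eq[OF Y_in_space[OF that], of g m] supp[of "Y m \<omega>"]
    by (cases "size_of (Y m \<omega>) = j") auto
  have out_eq: "out m = (\<integral>\<^sup>+s. indicator {0..t} s *
      (\<integral>\<^sup>+\<omega>. (ennreal (total_rate j) * g (Y m \<omega>)) * indicator {J m \<omega> ..< J (Suc m) \<omega>} (ereal s) \<partial>M) \<partial>lborel)" for m
  proof -
    have "out m = (\<integral>\<^sup>+s. indicator {0..t} s *
      (\<integral>\<^sup>+\<omega>. outflow_rate g (Y m \<omega>) * indicator {J m \<omega> ..< J (Suc m) \<omega>} (ereal s) \<partial>M) \<partial>lborel)"
      unfolding out_def outflow_rate_def
      using nn_integral_jumps_eq_sojourns[of "\<lambda>p. g (fst p)" m t] by simp
    also have "\<dots> = (\<integral>\<^sup>+s. indicator {0..t} s *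
      (\<integral>\<^sup>+\<omega>. (ennreal (total_rate j) * g (Y m \<omega>)) * indicator {J m \<omega> ..< J (Suc m) \<omega>} (ereal s) \<partial>M) \<partial>lborel)"
      by (intro nn_integral_cong arg_cong2[where f = times] refl) (simp add: outflow)
    finally show ?thesis .
  qed
  have "(\<integral>\<^sup>+\<omega>. g (Y 0 \<omega>) \<partial>M) + (\<integral>\<^sup>+s. indicator {0..t} s * mean (inflow_rate g) s \<partial>lborel) =
      a 0 + (\<Sum>m. a (Suc m))"
    by (simp only: a_0 a_Suc nn_integral_mean measurable_inflow_rate[OF g])
  also have "\<dots> = (\<Sum>m. a m)"
    using suminf_offset[of a 1] by (simp add: add.commute)
  also have "\<dots> = (\<Sum>m. out m) + (\<Sum>m. stay m)"
    by (simp only: split suminf_add[OF summableI summableI])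
  also have "(\<Sum>m. stay m) = mean g t"
    unfolding stay_def by (rule suminf_sojourns[OF g t])
  also have "(\<Sum>m. out m) = (\<integral>\<^sup>+s. indicator {0..t} s * mean (\<lambda>y. ennreal (total_rate j) * g y) s \<partial>lborel)"
    unfolding out_eq by (rule nn_integral_mean) measurable
  also have "\<dots> = (\<integral>\<^sup>+s. ennreal (total_rate j) * (indicator {0..t} s * mean g s) \<partial>lborel)"
  proof (intro nn_integral_cong)
    fix s :: real
    \<comment> \<open>Pulling the constant out requires \<open>S s\<close> to be measurable, which
      is available for \<open>0 \<le> s\<close>; outside the interval both sides are 0.\<close>
    show "indicator {0..t} s * mean (\<lambda>y. ennreal (total_rate j) * g y) s =
        ennreal (total_rate j) * (indicator {0..t} s * mean g s)"
      using measurable_compose[OF measurable_S g, of s]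
      by (cases "s \<in> {0..t}") (simp_all add: mean_def nn_integral_cmult)
  qed
  also have "\<dots> = ennreal (total_rate j) * (\<integral>\<^sup>+s. indicator {0..t} s * mean g s \<partial>lborel)"
    using measurable_mean[OF g] by (intro nn_integral_cmult) simp
  finally show ?thesis .
qed

text \<open>The expected \<open>g\<close> after an event of \<open>e\<close>. The cut-off to the
  source size makes it a function supported on one size, hence itself an admissible argument of the
  integral equation.\<close>

definition clock_gain :: "(state \<Rightarrow> ennreal) \<Rightarrow> 'c \<Rightarrow> state \<Rightarrow> ennreal" where
  "clock_gain g e y = indicator {src e} (size_of y) * (\<integral>\<^sup>+z. g z \<partial>K e y)"

lemma measurable_clock_gain:
  assumes "e \<in> \<Xi>" and [measurable]: "g \<in> borel_measurable state_space"
  shows "clock_gain g e \<in> borel_measurable state_space"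
proof -
  have "(\<lambda>y. indicator {src e} (size_of y) :: ennreal) \<in> borel_measurable state_space"
    by (rule measurable_compose[OF measurable_size_of]) simp
  then show ?thesis
    unfolding clock_gain_def[abs_def]
    by (intro borel_measurable_times_ennreal
        measurable_compose[OF kernel_subprob nn_integral_measurable_subprob_algebra] assms)
qed

lemma clock_gain_le:
  assumes "e \<in> \<Xi>" "y \<in> space state_space" "\<And>z. z \<in> space state_space \<Longrightarrow> g z \<le> B"
  shows "clock_gain g e y \<le> B * indicator {src e} (size_of y)"
proof -
  interpret Ke: prob_space "K e y" by (rule prob_space_kernel[OF assms(1,2)])
  have "(\<integral>\<^sup>+z. g z \<partial>K e y) \<le> (\<integral>\<^sup>+z. B \<partial>K e y)"
    using assms(3) sets_eq_imp_space_eq[OF sets_kernel[OF assms(1,2)]]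
    by (intro nn_integral_mono) auto
  also have "\<dots> = B"
    by (simp add: Ke.emeasure_space_1)
  finally show ?thesis
    by (simp add: clock_gain_def split: split_indicator)
qed

text \<open>For each \<open>y\<close> only finitely many clocks run, but which ones depends on
  \<open>y\<close>. Passing to all clocks arriving at \<open>j\<close> makes the index set constant:
  \<open>arrival\<close> kills the clocks leading elsewhere, and the cut-off in
  \<open>clock_gain\<close> kills those with another source.\<close>

lemma inflow_rate_eq:
  assumes y: "y \<in> space state_space" and supp: "\<And>y. size_of y \<noteq> j \<Longrightarrow> g y = 0"
  shows "inflow_rate g y =
    (\<integral>\<^sup>+e. ennreal (rate e) * clock_gain g e y \<partial>count_space {\<epsilon> \<in> \<Xi>. arr \<epsilon> = j})"
proof -
  let ?C = "clocks (size_of y)"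
  have "(\<integral>\<^sup>+z. g z \<partial>K e y) = 0" if e: "e \<in> ?C" "arr e \<noteq> j" for e
  proof -
    have "AE z in K e y. size_of z = arr e"
      using e by (intro arrival y) (auto dest: clocksD)
    then have "(\<integral>\<^sup>+z. g z \<partial>K e y) = (\<integral>\<^sup>+z. 0 \<partial>K e y)"
      using e supp by (intro nn_integral_cong_AE) (auto elim!: eventually_mono)
    then show ?thesis by simp
  qed
  then have "inflow_rate g y = (\<Sum>e\<in>?C \<inter> {e. arr e = j}. ennreal (rate e) * (\<integral>\<^sup>+z. g z \<partial>K e y))"
    unfolding inflow_rate_def intensity_def by (intro sum.mono_neutral_cong_right) auto
  also have "\<dots> = (\<Sum>e\<in>?C \<inter> {e. arr e = j}. ennreal (rate e) * clock_gain g e y)"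
    by (intro sum.cong) (auto simp: clock_gain_def dest: clocksD)
  also have "\<dots> = (\<integral>\<^sup>+e. ennreal (rate e) * clock_gain g e y \<partial>count_space {\<epsilon> \<in> \<Xi>. arr \<epsilon> = j})"
    using finite_clocks'[of "size_of y"]
    by (intro nn_integral_count_space'[symmetric]) (auto simp: clock_gain_def clocks_def)
  finally show ?thesis .
qed

lemma countable_clocks: "countable \<Xi>"
proof -
  have "\<Xi> = (\<Union>n. clocks n)" by (auto simp: clocks_def)
  then show ?thesis
    using countable_UN[of UNIV clocks] by (simp add: countable_finite)
qed

text \<open>Tonelli with the counting measure; there are countably many clocks because each size is
  the source of finitely many.\<close>

lemma mean_inflow_rate:
  assumes g: "g \<in> borel_measurable state_space"
    and supp: "\<And>y. size_of y \<noteq> j \<Longrightarrow> g y = 0" and s: "0 \<le> s"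
  shows "mean (inflow_rate g) s =
    (\<integral>\<^sup>+e. ennreal (rate e) * mean (clock_gain g e) s \<partial>count_space {\<epsilon> \<in> \<Xi>. arr \<epsilon> = j})"
proof -
  let ?A = "{\<epsilon> \<in> \<Xi>. arr \<epsilon> = j}"
  have meas: "(\<lambda>\<omega>. clock_gain g e (S s \<omega>)) \<in> borel_measurable M" if "e \<in> ?A" for e
    using that by (intro measurable_compose[OF measurable_S[OF s] measurable_clock_gain[OF _ g]]) auto
  have "mean (inflow_rate g) s =
      (\<integral>\<^sup>+\<omega>. \<integral>\<^sup>+e. ennreal (rate e) * clock_gain g e (S s \<omega>) \<partial>count_space ?A \<partial>M)"
    unfolding mean_def
    using measurable_space[OF measurable_S[OF s]] supp
    by (intro nn_integral_cong inflow_rate_eq) auto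
  also have "\<dots> = (\<integral>\<^sup>+e. \<integral>\<^sup>+\<omega>. ennreal (rate e) * clock_gain g e (S s \<omega>) \<partial>M \<partial>count_space ?A)"
    by (intro nn_integral_count_space_nn_integral borel_measurable_times_ennreal
        borel_measurable_const meas countable_subset[OF _ countable_clocks]) auto
  also have "\<dots> = (\<integral>\<^sup>+e. ennreal (rate e) * mean (clock_gain g e) s \<partial>count_space ?A)"
    using meas unfolding mean_def by (intro nn_integral_cong nn_integral_cmult) auto
  finally show ?thesis .
qed

end

text \<open>A Weierstrass test with a dominating series that itself depends on \<open>r\<close>:
  every remainder of \<open>V\<close> lies between 0 and \<open>B\<close> times the corresponding
  remainder of \<open>P\<close>, and the latter is small uniformly in \<open>r\<close>.\<close>

lemma uniform_limit_dominated_sum: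
  fixes V P :: "'a \<Rightarrow> 'b \<Rightarrow> real"
  assumes lim: "uniform_limit N (\<lambda>C r. \<Sum>e\<in>C. P e r) l (finite_subsets_at_top A)"
    and V: "\<And>e r. e \<in> A \<Longrightarrow> r \<in> N \<Longrightarrow> 0 \<le> V e r"
      "\<And>e r. e \<in> A \<Longrightarrow> r \<in> N \<Longrightarrow> V e r \<le> B * P e r"
    and B: "0 < B"
  shows "\<And>r. r \<in> N \<Longrightarrow> (\<lambda>e. V e r) summable_on A"
    and "uniform_limit N (\<lambda>C r. \<Sum>e\<in>C. V e r) (\<lambda>r. \<Sum>\<^sub>\<infinity>e\<in>A. V e r) (finite_subsets_at_top A)"
proof -
  have P: "((\<lambda>e. P e r) has_sum l r) A" if "r \<in> N" for r
    using tendsto_uniform_limitI[OF lim that] by (simp add: has_sum_def)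
  have BP: "((\<lambda>e. B * P e r) has_sum (B * l r)) A" if "r \<in> N" for r
    using P[OF that] by (rule has_sum_cmult_right)
  show summable: "(\<lambda>e. V e r) summable_on A" if "r \<in> N" for r
    using has_sum_imp_summable[OF BP[OF that]]
    by (rule summable_on_comparison_test) (use V that in auto)
  show "uniform_limit N (\<lambda>C r. \<Sum>e\<in>C. V e r) (\<lambda>r. \<Sum>\<^sub>\<infinity>e\<in>A. V e r) (finite_subsets_at_top A)"
  proof (rule uniform_limitI)
    fix \<epsilon> :: real assume "0 < \<epsilon>"
    then have "0 < \<epsilon> / B" using B by simp
    from uniform_limitD[OF lim this]
    have "\<forall>\<^sub>F C in finite_subsets_at_top A.
        (\<forall>r\<in>N. dist (\<Sum>e\<in>C. P e r) (l r) < \<epsilon> / B) \<and> finite C \<and> C \<subseteq> A"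
      by (rule eventually_conj) (rule eventually_finite_subsets_at_top_weakI, simp)
    then show "\<forall>\<^sub>F C in finite_subsets_at_top A.
        \<forall>r\<in>N. dist (\<Sum>e\<in>C. V e r) (\<Sum>\<^sub>\<infinity>e\<in>A. V e r) < \<epsilon>"
    proof (rule eventually_mono, safe)
      fix C r assume C: "\<forall>r\<in>N. dist (\<Sum>e\<in>C. P e r) (l r) < \<epsilon> / B" "finite C" "C \<subseteq> A"
        and r: "r \<in> N"
      \<comment> \<open>Both remainders are written as sums over \<open>A - C\<close>, so that they
        can be compared term by term.\<close>
      have dV: "((\<lambda>e. V e r) has_sum ((\<Sum>\<^sub>\<infinity>e\<in>A. V e r) - (\<Sum>e\<in>C. V e r))) (A - C)"
        using C summable[OF r] by (intro has_sum_Diff has_sum_infsum has_sum_finite) auto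
      have dP: "((\<lambda>e. B * P e r) has_sum (B * l r - (\<Sum>e\<in>C. B * P e r))) (A - C)"
        using C BP[OF r] by (intro has_sum_Diff has_sum_finite) auto
      have "0 \<le> (\<Sum>\<^sub>\<infinity>e\<in>A. V e r) - (\<Sum>e\<in>C. V e r)"
        using dV by (rule has_sum_nonneg) (use V r in auto)
      moreover have "(\<Sum>\<^sub>\<infinity>e\<in>A. V e r) - (\<Sum>e\<in>C. V e r) \<le> B * l r - (\<Sum>e\<in>C. B * P e r)"
        using dV dP by (rule has_sum_mono) (use V r in auto)
      moreover have "B * l r - (\<Sum>e\<in>C. B * P e r) = B * (l r - (\<Sum>e\<in>C. P e r))"
        by (simp add: sum_distrib_left right_diff_distrib)
      moreover have "B * (l r - (\<Sum>e\<in>C. P e r)) < B * (\<epsilon> / B)"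
        using C(1) r B by (intro mult_strict_left_mono) (auto simp: dist_real_def abs_less_iff)
      ultimately show "dist (\<Sum>e\<in>C. V e r) (\<Sum>\<^sub>\<infinity>e\<in>A. V e r) < \<epsilon>"
        using B by (simp add: dist_real_def)
    qed
  qed
qed

lemma has_real_derivative_transform_on:
  fixes f g :: "real \<Rightarrow> real"
  assumes "(f has_real_derivative D) (at t within S)" "t \<in> S" "\<And>s. s \<in> S \<Longrightarrow> g s = f s"
  shows "(g has_real_derivative D) (at t within S)"
  using assms(1) zero_less_one assms(2)
  by (rule has_field_derivative_transform_within) (simp add: assms(3))

section \<open>Continuity and differentiation of the integral equation\<close>

context clock_jump_process
begin

lemma measurable_size_event:
  assumes "0 \<le> s"
  shows "size_event M S j s \<in> sets M"
proof -
  have "(\<lambda>\<omega>. size_of (S s \<omega>)) \<in> M \<rightarrow>\<^sub>M count_space UNIV"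
    by (rule measurable_compose[OF measurable_S[OF assms] measurable_size_of])
  then have "(\<lambda>\<omega>. size_of (S s \<omega>)) -` {j} \<inter> space M \<in> sets M"
    by (rule measurable_sets) simp
  also have "(\<lambda>\<omega>. size_of (S s \<omega>)) -` {j} \<inter> space M = size_event M S j s"
    by (auto simp: size_event_def)
  finally show ?thesis .
qed

lemma mean_le:
  assumes "0 \<le> s" "\<And>y. y \<in> space state_space \<Longrightarrow> g y \<le> B"
  shows "mean g s \<le> B"
proof -
  have "mean g s \<le> (\<integral>\<^sup>+\<omega>. B \<partial>M)"
    unfolding mean_def using assms measurable_space[OF measurable_S[OF assms(1)]]
    by (intro nn_integral_mono) auto
  then show ?thesis
    by (simp add: emeasure_space_1)
qed

text \<open>This domination carries \<open>inflow_converges\<close>, which speaks of size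
  probabilities only, over to the gains of an arbitrary bounded \<open>g\<close>.\<close>

lemma mean_clock_gain_le:
  assumes e: "e \<in> \<Xi>" and g: "\<And>y. y \<in> space state_space \<Longrightarrow> g y \<le> ennreal B"
    and s: "0 \<le> s" and B: "0 \<le> B"
  shows "mean (clock_gain g e) s \<le> ennreal (B * size_prob M S (src e) s)"
proof -
  have "mean (clock_gain g e) s \<le> (\<integral>\<^sup>+\<omega>. ennreal B * indicator (size_event M S (src e) s) \<omega> \<partial>M)"
    unfolding mean_def
  proof (rule nn_integral_mono)
    fix \<omega> assume \<omega>: "\<omega> \<in> space M"
    show "clock_gain g e (S s \<omega>) \<le> ennreal B * indicator (size_event M S (src e) s) \<omega>"
      using clock_gain_le[OF e measurable_space[OF measurable_S[OF s] \<omega>] g] \<omega>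
      by (simp add: size_event_def indicator_def)
  qed
  also have "\<dots> = ennreal (B * size_prob M S (src e) s)"
    using measurable_size_event[OF s, of "src e"] B
    by (simp add: nn_integral_cmult_indicator emeasure_eq_measure size_prob_def ennreal_mult)
  finally show ?thesis .
qed

context
  fixes g :: "state \<Rightarrow> ennreal" and j :: nat and B :: real
  assumes g: "g \<in> borel_measurable state_space"
    and supp: "\<And>y. size_of y \<noteq> j \<Longrightarrow> g y = 0"
    and bound: "\<And>y. y \<in> space state_space \<Longrightarrow> g y \<le> ennreal B"
    and B: "0 < B"
begin

lemma mean_finite: "0 \<le> s \<Longrightarrow> mean g s < \<infinity>"
  using mean_le[of s g "ennreal B"] bound by (auto intro: le_less_trans)

lemma nn_integral_mean_finite: "(\<integral>\<^sup>+s. indicator {0..t} s * mean g s \<partial>lborel) < \<infinity>"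
proof -
  have "(\<integral>\<^sup>+s. indicator {0..t} s * mean g s \<partial>lborel) \<le> (\<integral>\<^sup>+s. ennreal B * indicator {0..t} s \<partial>lborel)"
    using mean_le[of _ g "ennreal B"] bound by (intro nn_integral_mono) (auto split: split_indicator)
  also have "\<dots> = ennreal B * emeasure lborel {0..t}"
    by (simp add: nn_integral_cmult_indicator)
  also have "\<dots> < \<infinity>"
    by (cases "0 \<le> t") (simp_all add: ennreal_mult_less_top)
  finally show ?thesis .
qed

lemma initial_finite: "(\<integral>\<^sup>+\<omega>. g (Y 0 \<omega>) \<partial>M) < \<infinity>"
proof -
  have "(\<integral>\<^sup>+\<omega>. g (Y 0 \<omega>) \<partial>M) \<le> (\<integral>\<^sup>+\<omega>. ennreal B \<partial>M)"
    using bound Y_in_space by (intro nn_integral_mono) auto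
  then show ?thesis
    by (simp add: emeasure_space_1 le_less_trans)
qed

text \<open>No bound on the inflow rate itself is at hand. By \<open>balance\<close> its time
  integral is at most the outflow, which has the finite rate \<open>total_rate j\<close>, plus the
  mass at time \<open>t\<close>.\<close>

lemma nn_integral_inflow_finite:
  assumes "0 \<le> t"
  shows "(\<integral>\<^sup>+s. indicator {0..t} s * mean (inflow_rate g) s \<partial>lborel) < \<infinity>"
proof -
  have "(\<integral>\<^sup>+s. indicator {0..t} s * mean (inflow_rate g) s \<partial>lborel) \<le>
      (\<integral>\<^sup>+\<omega>. g (Y 0 \<omega>) \<partial>M) + (\<integral>\<^sup>+s. indicator {0..t} s * mean (inflow_rate g) s \<partial>lborel)"
    by simp
  also have "\<dots> = ennreal (total_rate j) * (\<integral>\<^sup>+s. indicator {0..t} s * mean g s \<partial>lborel) + mean g t"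
    by (rule balance[OF g supp assms])
  also have "\<dots> < \<infinity>"
    using nn_integral_mean_finite[of t] mean_finite[OF assms] by (simp add: ennreal_mult_less_top)
  finally show ?thesis .
qed

text \<open>All terms of \<open>balance\<close> are finite, so it can be transferred to the reals
  and solved for the mass at time \<open>t\<close>.\<close>

lemma integral_equation:
  assumes "0 \<le> t"
  shows "(\<lambda>s. enn2real (mean (inflow_rate g) s) - total_rate j * enn2real (mean g s)) integrable_on {0..t}"
    and "enn2real (mean g t) = enn2real (\<integral>\<^sup>+\<omega>. g (Y 0 \<omega>) \<partial>M) +
      integral {0..t} (\<lambda>s. enn2real (mean (inflow_rate g) s) - total_rate j * enn2real (mean g s))"
proof -
  let ?G = "\<integral>\<^sup>+s. indicator {0..t} s * mean g s \<partial>lborel"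
  let ?I = "\<integral>\<^sup>+s. indicator {0..t} s * mean (inflow_rate g) s \<partial>lborel"
  have "((\<lambda>s. enn2real (mean (inflow_rate g) s) - total_rate j * enn2real (mean g s)) has_integral
      (enn2real ?I - total_rate j * enn2real ?G)) {0..t}"
    by (intro has_integral_diff has_integral_mult_right nn_integral_Icc_has_integral
        measurable_mean measurable_inflow_rate g nn_integral_mean_finite nn_integral_inflow_finite assms)
  moreover have "enn2real (\<integral>\<^sup>+\<omega>. g (Y 0 \<omega>) \<partial>M) + enn2real ?I = total_rate j * enn2real ?G + enn2real (mean g t)"
    using arg_cong[where f = enn2real, OF balance[OF g supp assms]] initial_finite
      nn_integral_inflow_finite[OF assms] nn_integral_mean_finite[of t] mean_finite[OF assms]
      total_rate_nonneg[of j]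
    by (simp add: enn2real_plus enn2real_mult ennreal_mult_less_top)
  ultimately show "(\<lambda>s. enn2real (mean (inflow_rate g) s) - total_rate j * enn2real (mean g s)) integrable_on {0..t}"
    and "enn2real (mean g t) = enn2real (\<integral>\<^sup>+\<omega>. g (Y 0 \<omega>) \<partial>M) +
      integral {0..t} (\<lambda>s. enn2real (mean (inflow_rate g) s) - total_rate j * enn2real (mean g s))"
    by (auto simp: integral_unique intro: has_integral_integrable)
qed

lemma continuous_on_mean: "continuous_on {0..} (\<lambda>s. enn2real (mean g s))"
proof (rule continuous_on_subset)
  have "continuous_on {0..T} (\<lambda>s. enn2real (mean g s))" if "0 \<le> T" for T
  proof (rule continuous_on_eq)
    show "continuous_on {0..T} (\<lambda>u. enn2real (\<integral>\<^sup>+\<omega>. g (Y 0 \<omega>) \<partial>M) + integral {0..u}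
        (\<lambda>s. enn2real (mean (inflow_rate g) s) - total_rate j * enn2real (mean g s)))"
      by (intro continuous_intros indefinite_integral_continuous_1 integral_equation(1) that)
  qed (simp add: integral_equation(2))
  then have "continuous (at s within {0..}) (\<lambda>s. enn2real (mean g s))" if "0 \<le> s" for s
  proof -
    \<comment> \<open>The equation gives continuity on compact intervals; leaving room to the right
      of \<open>s\<close> makes this continuity within the whole half-line.\<close>
    have "at s within {0..} = at s within {0..s + 1}"
      by (rule at_within_nhd[of _ "{..<s + 1}"]) auto
    moreover have "continuous (at s within {0..s + 1}) (\<lambda>s. enn2real (mean g s))"
      using \<open>\<And>T. 0 \<le> T \<Longrightarrow> continuous_on {0..T} (\<lambda>s. enn2real (mean g s))\<close>[of "s + 1"] that
      by (simp add: continuous_on_eq_continuous_within)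
    ultimately show ?thesis by simp
  qed
  then show "continuous_on {0..} (\<lambda>s. enn2real (mean g s))"
    by (simp add: continuous_on_eq_continuous_within)
qed simp

end

lemma mean_has_derivative:
  assumes g: "g \<in> borel_measurable state_space"
    and supp: "\<And>y. size_of y \<noteq> j \<Longrightarrow> g y = 0"
    and bound: "\<And>y. y \<in> space state_space \<Longrightarrow> g y \<le> ennreal B" and B: "0 < B"
    and t: "0 \<le> t" and regular: "inflow_converges M S \<Xi> rate src arr j t"
  shows "(\<lambda>e. rate e * enn2real (mean (clock_gain g e) t)) summable_on {\<epsilon> \<in> \<Xi>. arr \<epsilon> = j}"
    and "((\<lambda>s. enn2real (mean g s)) has_real_derivative
      (\<Sum>\<^sub>\<infinity>e\<in>{\<epsilon> \<in> \<Xi>. arr \<epsilon> = j}. rate e * enn2real (mean (clock_gain g e) t)) -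
        total_rate j * enn2real (mean g t)) (at t within {0..})"
proof -
  let ?A = "{\<epsilon> \<in> \<Xi>. arr \<epsilon> = j}"
  define V where "V e s = rate e * enn2real (mean (clock_gain g e) s)" for e s
  define w where "w s = enn2real (mean (inflow_rate g) s) - total_rate j * enn2real (mean g s)" for s
  obtain \<delta> l where \<delta>: "0 < \<delta>" and l: "uniform_limit ({0..} \<inter> cball t \<delta>)
      (\<lambda>C r. \<Sum>e\<in>C. rate e * size_prob M S (src e) r) l (finite_subsets_at_top ?A)"
    using regular unfolding inflow_converges_def by blast
  let ?N = "{0..} \<inter> cball t \<delta>"
  have gain_le: "mean (clock_gain g e) s \<le> ennreal (B * size_prob M S (src e) s)"
    if "e \<in> ?A" "0 \<le> s" for e s
    using that B bound by (intro mean_clock_gain_le) auto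
  have V_nonneg: "0 \<le> V e s" if "e \<in> ?A" for e s
    using that by (simp add: V_def rate_nonneg)
  have V_le: "V e s \<le> B * (rate e * size_prob M S (src e) s)" if "e \<in> ?A" "s \<in> ?N" for e s
  proof -
    have "enn2real (mean (clock_gain g e) s) \<le> B * size_prob M S (src e) s"
      using gain_le[OF that(1), of s] that B by (intro enn2real_leI) (auto simp: size_prob_def)
    then have "rate e * enn2real (mean (clock_gain g e) s) \<le> rate e * (B * size_prob M S (src e) s)"
      using that by (intro mult_left_mono rate_nonneg) auto
    then show ?thesis by (simp add: V_def ac_simps)
  qed
  note V_sum = uniform_limit_dominated_sum[OF l V_nonneg V_le B]
  have t_N: "t \<in> ?N" using t \<delta> by simp
  then show "(\<lambda>e. rate e * enn2real (mean (clock_gain g e) t)) summable_on ?A"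
    using V_sum(1) by (simp add: V_def)
  have V_cont: "continuous_on ?N (V e)" if e: "e \<in> ?A" for e
  proof -
    \<comment> \<open>The integral equation is used for \<open>clock_gain g e\<close> with
      \<open>src e\<close> in the role of \<open>j\<close>. The bound \<open>B\<close> is inherited
      because the kernel averages.\<close>
    have "continuous_on {0..} (\<lambda>s. enn2real (mean (clock_gain g e) s))"
    proof (rule continuous_on_mean[where j = "src e" and B = B])
      show "clock_gain g e y = 0" if "size_of y \<noteq> src e" for y
        using that by (simp add: clock_gain_def)
      show "clock_gain g e y \<le> ennreal B" if "y \<in> space state_space" for y
      proof -
        have "clock_gain g e y \<le> ennreal B * indicator {src e} (size_of y)"
          using e that bound by (intro clock_gain_le) auto
        also have "\<dots> \<le> ennreal B" by (simp split: split_indicator)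
        finally show ?thesis .
      qed
    qed (use e g B in \<open>auto intro: measurable_clock_gain\<close>)
    then have "continuous_on ?N (\<lambda>s. enn2real (mean (clock_gain g e) s))"
      by (rule continuous_on_subset) auto
    then show ?thesis
      unfolding V_def by (intro continuous_intros)
  qed
  have V_inf_cont: "continuous_on ?N (\<lambda>s. \<Sum>\<^sub>\<infinity>e\<in>?A. V e s)"
  proof (rule uniform_limit_theorem[OF _ V_sum(2)])
    show "\<forall>\<^sub>F C in finite_subsets_at_top ?A. continuous_on ?N (\<lambda>s. \<Sum>e\<in>C. V e s)"
      by (intro eventually_finite_subsets_at_top_weakI continuous_on_sum V_cont) auto
  qed simp_all
  \<comment> \<open>On \<open>?N\<close> domination makes the expected inflow a convergent sum.
    Elsewhere it might be infinite, and \<open>enn2real\<close> would then return 0.\<close>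
  have w_eq: "w s = (\<Sum>\<^sub>\<infinity>e\<in>?A. V e s) - total_rate j * enn2real (mean g s)" if s: "s \<in> ?N" for s
  proof -
    have "mean (inflow_rate g) s =
        (\<integral>\<^sup>+e. ennreal (rate e) * mean (clock_gain g e) s \<partial>count_space ?A)"
      by (rule mean_inflow_rate[OF g supp]) (use s in auto)
    also have "\<dots> = (\<integral>\<^sup>+e. ennreal (V e s) \<partial>count_space ?A)"
    proof (rule nn_integral_cong)
      fix e assume "e \<in> space (count_space ?A)"
      then have e: "e \<in> ?A" by simp
      have "mean (clock_gain g e) s < \<top>"
        using gain_le[OF e, of s] s by (auto intro: le_less_trans)
      then show "ennreal (rate e) * mean (clock_gain g e) s = ennreal (V e s)"
        using e by (simp add: V_def ennreal_mult rate_nonneg)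
    qed
    also have "\<dots> = ennreal (\<Sum>\<^sub>\<infinity>e\<in>?A. V e s)"
      using V_sum(1)[of s] s V_nonneg by (intro nn_integral_count_space_infsum) auto
    finally have "mean (inflow_rate g) s = ennreal (\<Sum>\<^sub>\<infinity>e\<in>?A. V e s)" .
    moreover have "0 \<le> (\<Sum>\<^sub>\<infinity>e\<in>?A. V e s)"
      using V_nonneg by (rule infsum_nonneg)
    ultimately show ?thesis by (simp add: w_def)
  qed
  have "continuous_on ?N (\<lambda>s. (\<Sum>\<^sub>\<infinity>e\<in>?A. V e s) - total_rate j * enn2real (mean g s))"
    by (intro continuous_intros V_inf_cont continuous_on_subset[OF continuous_on_mean[OF g supp bound B]]) auto
  then have "continuous_on ?N w"
    by (rule continuous_on_eq) (simp add: w_eq)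
  then have w_cont: "continuous (at t within ?N) w"
    using t_N by (simp add: continuous_on_eq_continuous_within)
  have at_eq: "at t within {0..t + 1} = at t within {0..}"
    by (rule at_within_nhd[of _ "{..<t + 1}"]) auto
  have "at t within ?N = at t within {0..}"
    by (rule at_within_nhd[of _ "ball t \<delta>"]) (use \<delta> in auto)
  \<comment> \<open>The fundamental theorem is used in its pointwise form: integrability on
    \<open>{0..t + 1}\<close> and continuity at \<open>t\<close> suffice. The empty set is its set
    of exceptional points.\<close>
  then have "continuous (at t within ({0..t + 1} - {})) w"
    using w_cont by (simp add: at_eq)
  from integral_has_vector_derivative_continuous_at[OF _ _ _ this]
  have "((\<lambda>u. integral {0..u} w) has_vector_derivative w t) (at t within {0..})"
    using integral_equation(1)[OF g supp bound B, where t = "t + 1"] t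
    by (simp add: at_eq w_def[abs_def])
  then have "((\<lambda>u. integral {0..u} w) has_real_derivative w t) (at t within {0..})"
    by (simp add: has_real_derivative_iff_has_vector_derivative)
  then have "((\<lambda>u. enn2real (\<integral>\<^sup>+\<omega>. g (Y 0 \<omega>) \<partial>M) + integral {0..u} w) has_real_derivative w t) (at t within {0..})"
    by (auto intro!: derivative_eq_intros)
  then have "((\<lambda>s. enn2real (mean g s)) has_real_derivative w t) (at t within {0..})"
  proof (rule has_real_derivative_transform_on)
    fix s :: real assume "s \<in> {0..}"
    then show "enn2real (mean g s) = enn2real (\<integral>\<^sup>+\<omega>. g (Y 0 \<omega>) \<partial>M) + integral {0..s} w"
      using integral_equation(2)[OF g supp bound B, where t = s] by (simp add: w_def[abs_def])
  qed (use t in simp)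
  then show "((\<lambda>s. enn2real (mean g s)) has_real_derivative
      (\<Sum>\<^sub>\<infinity>e\<in>?A. rate e * enn2real (mean (clock_gain g e) t)) -
        total_rate j * enn2real (mean g t)) (at t within {0..})"
    using w_eq[OF t_N] by (simp add: V_def)
qed

end

subsection \<open>Signed and vector-valued functions\<close>

lemma has_sum_vec:
  fixes v :: "'a \<Rightarrow> real^'d"
  assumes "\<And>i. ((\<lambda>e. v e $ i) has_sum w $ i) A"
  shows "(v has_sum w) A"
  unfolding has_sum_def
proof (rule vec_tendstoI)
  fix i
  show "((\<lambda>C. sum v C $ i) \<longlongrightarrow> w $ i) (finite_subsets_at_top A)"
    using assms[of i] by (simp add: has_sum_def sum_component)
qed

lemma measurable_vec_component:
  fixes f :: "'a \<Rightarrow> real^'d"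
  assumes "f \<in> borel_measurable M"
  shows "(\<lambda>y. f y $ i) \<in> borel_measurable M"
  using assms
  by (rule measurable_compose)
    (intro borel_measurable_continuous_onI linear_continuous_on bounded_linear_vec_nth)

lemma has_vector_derivative_vec:
  fixes F :: "real \<Rightarrow> real^'d"
  assumes "\<And>i. ((\<lambda>u. F u $ i) has_real_derivative D $ i) (at t within S)"
  shows "(F has_vector_derivative D) (at t within S)"
  unfolding has_vector_derivative_def
proof (subst has_derivative_componentwise_within, safe)
  fix k :: "real^'d" assume "k \<in> Basis"
  then obtain i where "k = axis i 1" by (auto simp: Basis_vec_def)
  then show "((\<lambda>x. F x \<bullet> k) has_derivative (\<lambda>x. (x *\<^sub>R D) \<bullet> k)) (at t within S)"
    using assms[of i] by (simp add: inner_axis has_field_derivative_def mult_commute_abs)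
qed

lemma integral_uniform_measure:
  fixes h :: "'a \<Rightarrow> 'b::{banach, second_countable_topology}"
  assumes "B \<in> sets M" "h \<in> borel_measurable M" "0 < measure M B"
  shows "measure M B *\<^sub>R (\<integral>x. h x \<partial>uniform_measure M B) = (\<integral>x. indicator B x *\<^sub>R h x \<partial>M)"
proof -
  \<comment> \<open>A set of infinite measure has \<open>measure\<close> 0, so positivity gives
    finiteness.\<close>
  have "emeasure M B = ennreal (measure M B)"
    using assms(3) by (metis emeasure_eq_ennreal_measure less_irrefl measure_def enn2real_top)
  then have "uniform_measure M B = density M (\<lambda>x. ennreal (indicator B x / measure M B))"
    unfolding uniform_measure_def using assms(3)
    by (intro arg_cong2[where f = density] refl ext)
      (auto simp: divide_ennreal[symmetric] split: split_indicator)
  then have "(\<integral>x. h x \<partial>uniform_measure M B) = (\<integral>x. (indicator B x / measure M B) *\<^sub>R h x \<partial>M)"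
    using assms by (simp add: integral_density)
  also have "\<dots> = (\<integral>x. (1 / measure M B) *\<^sub>R (indicator B x *\<^sub>R h x) \<partial>M)"
    by simp
  also have "\<dots> = (1 / measure M B) *\<^sub>R (\<integral>x. indicator B x *\<^sub>R h x \<partial>M)"
    by (rule integral_scaleR_right)
  finally show ?thesis
    using assms(3) by simp
qed

context clock_jump_process
begin

lemma measurable_indicator_size:
  "(\<lambda>y. indicator {j} (size_of y) :: 'x::{real_normed_algebra_1}) \<in> borel_measurable state_space"
  by (rule measurable_compose[OF measurable_size_of]) simp

text \<open>The expectation of \<open>h\<close> on the event of size \<open>j\<close>. It is the
  product of size probability and conditional mean without the division, so it is meaningful also
  when the probability is 0.\<close>

definition partial_mean :: "(state \<Rightarrow> real) \<Rightarrow> nat \<Rightarrow> real \<Rightarrow> real" where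
  "partial_mean h j s = (\<integral>\<omega>. indicator {j} (size_of (S s \<omega>)) * h (S s \<omega>) \<partial>M)"

definition kernel_mean :: "(state \<Rightarrow> real) \<Rightarrow> 'c \<Rightarrow> state \<Rightarrow> real" where
  "kernel_mean h e y = (\<integral>z. h z \<partial>K e y)"

lemma measurable_kernel_mean:
  fixes h :: "state \<Rightarrow> real"
  assumes "e \<in> \<Xi>" "h \<in> borel_measurable state_space"
  shows "kernel_mean h e \<in> borel_measurable state_space"
  unfolding kernel_mean_def[abs_def]
  by (rule measurable_compose[OF kernel_subprob[OF assms(1)] integral_measurable_subprob_algebra[OF assms(2)]])

lemma integrable_kernel:
  fixes h :: "state \<Rightarrow> real"
  assumes "e \<in> \<Xi>" "y \<in> space state_space" "h \<in> borel_measurable state_space"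
    and "\<And>z. z \<in> space state_space \<Longrightarrow> \<bar>h z\<bar> \<le> B"
  shows "integrable (K e y) h"
proof -
  interpret Ke: prob_space "K e y" by (rule prob_space_kernel[OF assms(1,2)])
  have "AE z in K e y. norm (h z) \<le> B"
    using assms(4) sets_eq_imp_space_eq[OF sets_kernel[OF assms(1,2)]] by (intro AE_I2) simp
  moreover have "h \<in> borel_measurable (K e y)"
    using assms(3) sets_kernel[OF assms(1,2)] by (simp cong: measurable_cong_sets)
  ultimately show ?thesis
    by (rule Ke.integrable_const_bound)
qed

lemma abs_kernel_mean_le:
  fixes h :: "state \<Rightarrow> real"
  assumes "e \<in> \<Xi>" "y \<in> space state_space" "h \<in> borel_measurable state_space"
    and "\<And>z. z \<in> space state_space \<Longrightarrow> \<bar>h z\<bar> \<le> B"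
  shows "\<bar>kernel_mean h e y\<bar> \<le> B"
proof -
  interpret Ke: prob_space "K e y" by (rule prob_space_kernel[OF assms(1,2)])
  have "\<bar>kernel_mean h e y\<bar> \<le> (\<integral>z. \<bar>h z\<bar> \<partial>K e y)"
    unfolding kernel_mean_def using integral_norm_bound[of "K e y" h] by simp
  also have "\<dots> \<le> (\<integral>z. B \<partial>K e y)"
    using assms(4) sets_eq_imp_space_eq[OF sets_kernel[OF assms(1,2)]] integrable_kernel[OF assms]
    by (intro integral_mono) auto
  finally show ?thesis
    by (simp add: Ke.prob_space)
qed

lemma integrable_partial_mean:
  fixes h :: "state \<Rightarrow> real"
  assumes s: "0 \<le> s" and h: "h \<in> borel_measurable state_space"
    and B: "\<And>z. z \<in> space state_space \<Longrightarrow> \<bar>h z\<bar> \<le> B"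
  shows "integrable M (\<lambda>\<omega>. indicator {j} (size_of (S s \<omega>)) * h (S s \<omega>))"
proof (rule integrable_const_bound)
  show "AE \<omega> in M. norm (indicator {j} (size_of (S s \<omega>)) * h (S s \<omega>)) \<le> B"
  proof (rule AE_I2)
    fix \<omega> assume "\<omega> \<in> space M"
    then have "\<bar>h (S s \<omega>)\<bar> \<le> B"
      using B measurable_space[OF measurable_S[OF s]] by blast
    then show "norm (indicator {j} (size_of (S s \<omega>)) * h (S s \<omega>)) \<le> B"
      by (auto split: split_indicator intro: order_trans[OF abs_ge_zero])
  qed
  show "(\<lambda>\<omega>. indicator {j} (size_of (S s \<omega>)) * h (S s \<omega>)) \<in> borel_measurable M"
    by (rule measurable_compose[OF measurable_S[OF s] borel_measurable_times[OF measurable_indicator_size h]])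
qed

lemma enn2real_mean:
  fixes h :: "state \<Rightarrow> real"
  assumes s: "0 \<le> s" and h: "h \<in> borel_measurable state_space"
    and nn: "\<And>z. z \<in> space state_space \<Longrightarrow> 0 \<le> h z"
    and g: "\<And>y. y \<in> space state_space \<Longrightarrow> g y = ennreal (indicator {j} (size_of y) * h y)"
  shows "enn2real (mean g s) = partial_mean h j s"
proof -
  have sp: "S s \<omega> \<in> space state_space" if "\<omega> \<in> space M" for \<omega>
    using that by (rule measurable_space[OF measurable_S[OF s]])
  have "mean g s = (\<integral>\<^sup>+\<omega>. ennreal (indicator {j} (size_of (S s \<omega>)) * h (S s \<omega>)) \<partial>M)"
    unfolding mean_def by (intro nn_integral_cong g sp)
  moreover have "partial_mean h j s =
      enn2real (\<integral>\<^sup>+\<omega>. ennreal (indicator {j} (size_of (S s \<omega>)) * h (S s \<omega>)) \<partial>M)"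
    unfolding partial_mean_def
    using nn sp
    by (intro integral_eq_nn_integral AE_I2
        measurable_compose[OF measurable_S[OF s] borel_measurable_times[OF measurable_indicator_size h]]) auto
  ultimately show ?thesis by simp
qed

text \<open>The kernel of \<open>e\<close> is concentrated on size \<open>j\<close> by
  \<open>arrival\<close>. Hence the cut-off that makes \<open>h\<close> vanish off size
  \<open>j\<close> is invisible after an event of \<open>e\<close>.\<close>

lemma clock_gain_eq_kernel_mean:
  fixes h :: "state \<Rightarrow> real"
  assumes e: "e \<in> \<Xi>" "arr e = j" and y: "y \<in> space state_space"
    and h: "h \<in> borel_measurable state_space"
    and nn: "\<And>z. z \<in> space state_space \<Longrightarrow> 0 \<le> h z"
    and B: "\<And>z. z \<in> space state_space \<Longrightarrow> h z \<le> B"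
  shows "clock_gain (\<lambda>z. ennreal (indicator {j} (size_of z) * h z)) e y =
    ennreal (indicator {src e} (size_of y) * kernel_mean h e y)"
proof (cases "size_of y = src e")
  case True
  have sp: "space (K e y) = space state_space"
    by (rule sets_eq_imp_space_eq[OF sets_kernel[OF e(1) y]])
  have "AE z in K e y. ennreal (indicator {j} (size_of z) * h z) = ennreal (h z)"
    using arrival[OF e(1) y True] by eventually_elim (simp add: e)
  then have "(\<integral>\<^sup>+z. ennreal (indicator {j} (size_of z) * h z) \<partial>K e y) = (\<integral>\<^sup>+z. ennreal (h z) \<partial>K e y)"
    by (rule nn_integral_cong_AE)
  also have "\<dots> = ennreal (kernel_mean h e y)"
    unfolding kernel_mean_def
    using nn B sp integrable_kernel[OF e(1) y h, of B] by (intro nn_integral_eq_integral AE_I2) auto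
  finally show ?thesis
    using True by (simp add: clock_gain_def)
qed (simp add: clock_gain_def)

lemma partial_mean_has_derivative_nonneg:
  fixes h :: "state \<Rightarrow> real"
  assumes h: "h \<in> borel_measurable state_space"
    and nn: "\<And>z. z \<in> space state_space \<Longrightarrow> 0 \<le> h z"
    and bound: "\<And>z. z \<in> space state_space \<Longrightarrow> h z \<le> B" and B: "0 < B"
    and t: "0 \<le> t" and regular: "inflow_converges M S \<Xi> rate src arr j t"
  shows "(\<lambda>e. rate e * partial_mean (kernel_mean h e) (src e) t) summable_on {\<epsilon> \<in> \<Xi>. arr \<epsilon> = j}"
    and "(partial_mean h j has_real_derivative
      (\<Sum>\<^sub>\<infinity>e\<in>{\<epsilon> \<in> \<Xi>. arr \<epsilon> = j}. rate e * partial_mean (kernel_mean h e) (src e) t) -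
        total_rate j * partial_mean h j t) (at t within {0..})"
proof -
  let ?A = "{\<epsilon> \<in> \<Xi>. arr \<epsilon> = j}"
  let ?g = "\<lambda>y. ennreal (indicator {j} (size_of y) * h y)"
  have g_meas: "?g \<in> borel_measurable state_space"
    using measurable_indicator_size[of j] h by measurable
  have g_le: "?g y \<le> ennreal B" if "y \<in> space state_space" for y
    using bound[OF that] B by (auto intro!: ennreal_leI split: split_indicator)
  note deriv = mean_has_derivative[of ?g j B, OF g_meas _ g_le B t regular]
  have mean_eq: "enn2real (mean ?g s) = partial_mean h j s" if "0 \<le> s" for s
    using that h nn by (rule enn2real_mean) simp_all
  have gain_eq: "enn2real (mean (clock_gain ?g e) t) = partial_mean (kernel_mean h e) (src e) t"
    if "e \<in> ?A" for e
  proof (rule enn2real_mean[OF t])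
    show "kernel_mean h e \<in> borel_measurable state_space"
      using that h by (intro measurable_kernel_mean) auto
    show "0 \<le> kernel_mean h e y" if "y \<in> space state_space" for y
      unfolding kernel_mean_def
      using \<open>e \<in> ?A\<close> that nn sets_eq_imp_space_eq[OF sets_kernel[of e y]]
      by (intro integral_nonneg_AE AE_I2) auto
    show "clock_gain ?g e y = ennreal (indicator {src e} (size_of y) * kernel_mean h e y)"
      if "y \<in> space state_space" for y
      using \<open>e \<in> ?A\<close> that nn bound h by (intro clock_gain_eq_kernel_mean) auto
  qed
  have "(\<lambda>e. rate e * enn2real (mean (clock_gain ?g e) t)) summable_on ?A"
    by (rule deriv(1)) auto
  then show "(\<lambda>e. rate e * partial_mean (kernel_mean h e) (src e) t) summable_on ?A"
    by (rule summable_on_cong[THEN iffD1, rotated]) (simp add: gain_eq)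
  have "((\<lambda>s. enn2real (mean ?g s)) has_real_derivative
      (\<Sum>\<^sub>\<infinity>e\<in>?A. rate e * enn2real (mean (clock_gain ?g e) t)) -
        total_rate j * enn2real (mean ?g t)) (at t within {0..})"
    by (rule deriv(2)) auto
  also have "(\<Sum>\<^sub>\<infinity>e\<in>?A. rate e * enn2real (mean (clock_gain ?g e) t)) =
      (\<Sum>\<^sub>\<infinity>e\<in>?A. rate e * partial_mean (kernel_mean h e) (src e) t)"
    by (intro infsum_cong) (simp add: gain_eq)
  finally have "((\<lambda>s. enn2real (mean ?g s)) has_real_derivative
      (\<Sum>\<^sub>\<infinity>e\<in>?A. rate e * partial_mean (kernel_mean h e) (src e) t) -
        total_rate j * partial_mean h j t) (at t within {0..})"
    using t by (simp only: mean_eq)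
  then show "(partial_mean h j has_real_derivative
      (\<Sum>\<^sub>\<infinity>e\<in>?A. rate e * partial_mean (kernel_mean h e) (src e) t) -
        total_rate j * partial_mean h j t) (at t within {0..})"
    by (rule has_real_derivative_transform_on) (use t mean_eq in auto)
qed

lemma partial_mean_diff:
  assumes s: "0 \<le> s" and "h1 \<in> borel_measurable state_space" "h2 \<in> borel_measurable state_space"
    and "\<And>z. z \<in> space state_space \<Longrightarrow> \<bar>h1 z\<bar> \<le> B" "\<And>z. z \<in> space state_space \<Longrightarrow> \<bar>h2 z\<bar> \<le> B"
    and eq: "\<And>z. z \<in> space state_space \<Longrightarrow> h z = h1 z - h2 z"
  shows "partial_mean h j s = partial_mean h1 j s - partial_mean h2 j s"
proof -
  have "partial_mean h j s =
      (\<integral>\<omega>. indicator {j} (size_of (S s \<omega>)) * h1 (S s \<omega>) - indicator {j} (size_of (S s \<omega>)) * h2 (S s \<omega>) \<partial>M)"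
    unfolding partial_mean_def using measurable_space[OF measurable_S[OF s]] eq
    by (intro Bochner_Integration.integral_cong) (auto simp: right_diff_distrib)
  also have "\<dots> = partial_mean h1 j s - partial_mean h2 j s"
    unfolding partial_mean_def using assms
    by (intro Bochner_Integration.integral_diff integrable_partial_mean) auto
  finally show ?thesis .
qed

text \<open>Every term is linear in \<open>h\<close>, and \<open>h\<close> is the difference of
  \<open>h + B\<close> and the constant \<open>B\<close>, both nonnegative and bounded by
  \<open>2 * B\<close>. The constant has a nontrivial equation of its own, that of the size
  probability scaled by \<open>B\<close>.\<close>

lemma partial_mean_has_derivative:
  fixes h :: "state \<Rightarrow> real"
  assumes h: "h \<in> borel_measurable state_space"
    and bound: "\<And>z. z \<in> space state_space \<Longrightarrow> \<bar>h z\<bar> \<le> B" and B: "0 < B"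
    and t: "0 \<le> t" and regular: "inflow_converges M S \<Xi> rate src arr j t"
  shows "(\<lambda>e. rate e * partial_mean (kernel_mean h e) (src e) t) summable_on {\<epsilon> \<in> \<Xi>. arr \<epsilon> = j}"
    and "(partial_mean h j has_real_derivative
      (\<Sum>\<^sub>\<infinity>e\<in>{\<epsilon> \<in> \<Xi>. arr \<epsilon> = j}. rate e * partial_mean (kernel_mean h e) (src e) t) -
        total_rate j * partial_mean h j t) (at t within {0..})"
proof -
  let ?A = "{\<epsilon> \<in> \<Xi>. arr \<epsilon> = j}"
  let ?h1 = "\<lambda>z. h z + B" and ?h2 = "\<lambda>z::state. B"
  let ?m = "\<lambda>h e. rate e * partial_mean (kernel_mean h e) (src e) t"
  have h1: "?h1 \<in> borel_measurable state_space" and h2: "?h2 \<in> borel_measurable state_space"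
    using h by auto
  have b1: "0 \<le> ?h1 z" "?h1 z \<le> 2 * B" "\<bar>?h1 z\<bar> \<le> 2 * B" "\<bar>?h2 z\<bar> \<le> 2 * B" if "z \<in> space state_space" for z
    using bound[OF that] B by auto
  note d1 = partial_mean_has_derivative_nonneg[OF h1 b1(1,2) _ t regular]
  note d2 = partial_mean_has_derivative_nonneg[of ?h2 B, OF h2 _ _ B t regular]
  have U_eq: "partial_mean h j s = partial_mean ?h1 j s - partial_mean ?h2 j s" if "0 \<le> s" for s
    using that h1 h2 b1(3,4) by (rule partial_mean_diff) auto
  have m_eq: "?m h e = ?m ?h1 e - ?m ?h2 e" if "e \<in> ?A" for e
  proof -
    have e: "e \<in> \<Xi>" using that by simp
    have "partial_mean (kernel_mean h e) (src e) t =
        partial_mean (kernel_mean ?h1 e) (src e) t - partial_mean (kernel_mean ?h2 e) (src e) t"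
    proof (rule partial_mean_diff[OF t, where B = "2 * B"])
      fix y assume y: "y \<in> space state_space"
      have "integrable (K e y) ?h1" "integrable (K e y) ?h2"
        using integrable_kernel[OF e y h1 b1(3)] integrable_kernel[OF e y h2 b1(4)] by auto
      from Bochner_Integration.integral_diff[OF this]
      show "kernel_mean h e y = kernel_mean ?h1 e y - kernel_mean ?h2 e y"
        by (simp add: kernel_mean_def)
    qed (use e h1 h2 b1 in \<open>auto intro!: measurable_kernel_mean abs_kernel_mean_le\<close>)
    then show ?thesis by (simp add: right_diff_distrib)
  qed
  have s1: "?m ?h1 summable_on ?A" and s2: "?m ?h2 summable_on ?A"
    using d1(1) d2(1) B by auto
  have sum: "(?m h has_sum ((\<Sum>\<^sub>\<infinity>e\<in>?A. ?m ?h1 e) - (\<Sum>\<^sub>\<infinity>e\<in>?A. ?m ?h2 e))) ?A"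
    using has_sum_add[OF has_sum_infsum[OF s1] has_sum_cmult_right[OF has_sum_infsum[OF s2], of "- 1"]]
    by (subst has_sum_cong[where g = "\<lambda>e. ?m ?h1 e + - 1 * ?m ?h2 e"]) (auto simp: m_eq)
  then show "?m h summable_on ?A"
    by (rule has_sum_imp_summable)
  have "((\<lambda>s. partial_mean ?h1 j s - partial_mean ?h2 j s) has_real_derivative
      ((\<Sum>\<^sub>\<infinity>e\<in>?A. ?m ?h1 e) - total_rate j * partial_mean ?h1 j t) -
      ((\<Sum>\<^sub>\<infinity>e\<in>?A. ?m ?h2 e) - total_rate j * partial_mean ?h2 j t)) (at t within {0..})"
    by (intro DERIV_diff d1(2) d2(2)) (use B in auto)
  then have "((\<lambda>s. partial_mean ?h1 j s - partial_mean ?h2 j s) has_real_derivative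
      (\<Sum>\<^sub>\<infinity>e\<in>?A. ?m h e) - total_rate j * partial_mean h j t) (at t within {0..})"
    by (rule DERIV_cong) (simp add: infsumI[OF sum] U_eq[OF t] right_diff_distrib)
  then show "(partial_mean h j has_real_derivative
      (\<Sum>\<^sub>\<infinity>e\<in>?A. ?m h e) - total_rate j * partial_mean h j t) (at t within {0..})"
    by (rule has_real_derivative_transform_on) (use t U_eq in auto)
qed

end

section \<open>From kernel averages to conditional means by the affine hypothesis\<close>

context clock_jump_process
begin

lemma size_prob_times_cond_mean:
  fixes f :: "state \<Rightarrow> real^'d"
  assumes s: "0 \<le> s" and f: "f \<in> borel_measurable state_space"
    and bound: "\<And>y. y \<in> space state_space \<Longrightarrow> norm (f y) \<le> B"
  shows "(size_prob M S j s *\<^sub>R cond_mean M S f j s) $ i = partial_mean (\<lambda>y. f y $ i) j s"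
proof -
  let ?E = "size_event M S j s"
  have E: "?E \<in> sets M" by (rule measurable_size_event[OF s])
  have fS: "(\<lambda>\<omega>. f (S s \<omega>)) \<in> borel_measurable M"
    by (rule measurable_compose[OF measurable_S[OF s] f])
  have fS_bound: "norm (f (S s \<omega>)) \<le> B" if "\<omega> \<in> space M" for \<omega>
    using bound measurable_space[OF measurable_S[OF s] that] by blast
  have int: "integrable M (\<lambda>\<omega>. indicator ?E \<omega> *\<^sub>R f (S s \<omega>))"
    using E fS_bound
    by (intro integrable_mult_indicator integrable_const_bound[OF _ fS] AE_I2) auto
  have "size_prob M S j s *\<^sub>R cond_mean M S f j s = (\<integral>\<omega>. indicator ?E \<omega> *\<^sub>R f (S s \<omega>) \<partial>M)"
  proof (cases "size_prob M S j s = 0")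
    case True
    then have "AE \<omega> in M. \<omega> \<notin> ?E"
      using E by (auto simp: size_prob_def emeasure_eq_measure intro!: AE_not_in null_setsI)
    then have "(\<integral>\<omega>. indicator ?E \<omega> *\<^sub>R f (S s \<omega>) \<partial>M) = (\<integral>\<omega>. 0 \<partial>M)"
      using E fS by (intro integral_cong_AE borel_measurable_scaleR borel_measurable_indicator)
        (auto elim!: eventually_mono)
    with True show ?thesis by simp
  next
    case False
    then have "0 < measure M ?E"
      by (simp add: size_prob_def zero_less_measure_iff)
    from integral_uniform_measure[OF E fS this] show ?thesis
      by (simp add: size_prob_def cond_mean_def)
  qed
  then have "(size_prob M S j s *\<^sub>R cond_mean M S f j s) $ i =
      (\<integral>\<omega>. (indicator ?E \<omega> *\<^sub>R f (S s \<omega>)) $ i \<partial>M)"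
    using integral_bounded_linear[OF bounded_linear_vec_nth int, of i] by simp
  also have "\<dots> = partial_mean (\<lambda>y. f y $ i) j s"
    unfolding partial_mean_def
    by (intro Bochner_Integration.integral_cong) (auto simp: size_event_def indicator_def)
  finally show ?thesis .
qed

text \<open>
  By the tower property, averaging the affine identity over the law of an event of \<open>e\<close> removes the
  conditioning on \<open>f\<close> before the event.
\<close>

lemma partial_mean_kernel_mean:
  fixes f :: "state \<Rightarrow> real^'d" and A :: "real^'d^'d" and b :: "real^'d"
  assumes e: "e \<in> \<Xi>" and s: "0 \<le> s" and f: "f \<in> borel_measurable state_space"
    and bound: "\<And>y. y \<in> space state_space \<Longrightarrow> norm (f y) \<le> B"
    and affine: "0 < size_prob M S (src e) s \<Longrightarrow>
      AE p in event_law M S src K e s. event_cond_exp M S src K f e s p = A *v f (fst p) + b"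
  shows "partial_mean (kernel_mean (\<lambda>y. f y $ i) e) (src e) s =
    (size_prob M S (src e) s *\<^sub>R (A *v cond_mean M S f (src e) s + b)) $ i"
proof (cases "size_prob M S (src e) s = 0")
  \<comment> \<open>The affine hypothesis is guarded by a positive probability. Here both sides
    vanish, the left one because its integrand lives on a null event.\<close>
  case True
  let ?E = "size_event M S (src e) s"
  have "AE \<omega> in M. \<omega> \<notin> ?E"
    using True measurable_size_event[OF s, of "src e"]
    by (auto simp: size_prob_def emeasure_eq_measure intro!: AE_not_in null_setsI)
  then have "AE \<omega> in M. indicator {src e} (size_of (S s \<omega>)) * kernel_mean (\<lambda>y. f y $ i) e (S s \<omega>) = 0"
    using AE_space by eventually_elim (auto simp: size_event_def)
  then have "partial_mean (kernel_mean (\<lambda>y. f y $ i) e) (src e) s = 0"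
    unfolding partial_mean_def by (rule integral_eq_zero_AE)
  with True show ?thesis by simp
next
  case False
  let ?E = "size_event M S (src e) s" and ?\<pi> = "size_prob M S (src e) s"
  let ?SS = "state_space \<Otimes>\<^sub>M state_space"
  have E: "?E \<in> sets M" by (rule measurable_size_event[OF s])
  have pos: "0 < ?\<pi>" using False by (simp add: size_prob_def zero_less_measure_iff)
  define N where "N = uniform_measure M ?E"
  define D where "D = distr N state_space (S s)"
  define k where "k = (\<lambda>y. distr (K e y) ?SS (\<lambda>z. (y, z)))"
  define Q where "Q = event_law M S src K e s"
  have Q_eq: "Q = D \<bind> k"
    by (simp add: Q_def event_law_def D_def N_def k_def)
  interpret N: prob_space N
    unfolding N_def using pos
    by (intro prob_space_uniform_measure) (auto simp: emeasure_eq_measure size_prob_def)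
  have S_N: "S s \<in> N \<rightarrow>\<^sub>M state_space"
    using measurable_S[OF s] by (simp add: N_def cong: measurable_cong_sets)
  have D: "D \<in> space (prob_algebra state_space)"
    using N.prob_space_distr[OF S_N] by (simp add: D_def space_prob_algebra)
  have sets_D: "sets D = sets state_space" by (simp add: D_def)
  interpret D: prob_space D using D by (simp add: space_prob_algebra)
  have k: "k \<in> state_space \<rightarrow>\<^sub>M prob_algebra ?SS"
    unfolding k_def by (rule measurable_distr_prob_space2[OF kernel[OF e]]) simp
  have k_D: "k \<in> D \<rightarrow>\<^sub>M subprob_algebra ?SS"
    using measurable_prob_algebraD[OF k] sets_D by (simp cong: measurable_cong_sets)
  have sets_Q: "sets Q = sets ?SS" unfolding Q_eq by (rule sets_bind'[OF D k])
  interpret Q: prob_space Q unfolding Q_eq by (rule prob_space_bind'[OF D k])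
  have space_Q: "space Q = space ?SS" using sets_Q by (rule sets_eq_imp_space_eq)
  \<comment> \<open>Disintegration: the state before the event is drawn from \<open>D\<close>, the
    state after it from the kernel. The bound \<open>B' = 1\<close> is the total mass of each
    \<open>k y\<close>.\<close>
  have integral_Q: "(\<integral>p. \<phi> p \<partial>Q) = (\<integral>y. (\<integral>z. \<phi> (y, z) \<partial>K e y) \<partial>D)"
    if \<phi>: "\<phi> \<in> borel_measurable ?SS" "\<And>p. p \<in> space ?SS \<Longrightarrow> \<bar>\<phi> p\<bar> \<le> C" for \<phi> :: "state \<times> state \<Rightarrow> real" and C
  proof -
    have "(\<integral>p. \<phi> p \<partial>Q) = (\<integral>y. (\<integral>p. \<phi> p \<partial>k y) \<partial>D)"
      unfolding Q_eq
    proof (rule integral_bind[OF \<phi> k_D, where B' = 1])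
      have "emeasure (k y) (space (k y)) = 1" if "y \<in> space D" for y
        using measurable_space[OF k, of y] that sets_eq_imp_space_eq[OF sets_D]
        by (auto simp: space_prob_algebra prob_space.emeasure_space_1)
      then show "AE y in D. emeasure (k y) (space (k y)) \<le> ennreal 1"
        by (intro AE_I2) simp
    qed (auto intro: D.finite_measure_axioms)
    also have "\<dots> = (\<integral>y. (\<integral>z. \<phi> (y, z) \<partial>K e y) \<partial>D)"
    proof (rule Bochner_Integration.integral_cong[OF refl])
      fix y assume "y \<in> space D"
      then have y: "y \<in> space state_space" using sets_eq_imp_space_eq[OF sets_D] by simp
      have "(\<lambda>z. (y, z)) \<in> K e y \<rightarrow>\<^sub>M ?SS"
        using measurable_Pair1'[OF y, of state_space] sets_kernel[OF e y]
        by (simp cong: measurable_cong_sets)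
      then show "(\<integral>p. \<phi> p \<partial>k y) = (\<integral>z. \<phi> (y, z) \<partial>K e y)"
        unfolding k_def using \<phi>(1) by (rule integral_distr)
    qed
    finally show ?thesis .
  qed
  \<comment> \<open>Multiplying by the probability of the source size undoes the normalisation of
    the conditional law.\<close>
  have integral_D: "?\<pi> * (\<integral>y. h y \<partial>D) = partial_mean h (src e) s"
    if h: "h \<in> borel_measurable state_space" for h
  proof -
    have hS: "(\<lambda>\<omega>. h (S s \<omega>)) \<in> borel_measurable M"
      by (rule measurable_compose[OF measurable_S[OF s] h])
    have "?\<pi> * (\<integral>y. h y \<partial>D) = ?\<pi> * (\<integral>\<omega>. h (S s \<omega>) \<partial>N)"
      by (simp add: D_def integral_distr[OF S_N h])
    also have "\<dots> = (\<integral>\<omega>. indicator ?E \<omega> * h (S s \<omega>) \<partial>M)"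
      using integral_uniform_measure[OF E hS] pos by (simp add: N_def size_prob_def)
    also have "\<dots> = partial_mean h (src e) s"
      unfolding partial_mean_def
      by (intro Bochner_Integration.integral_cong) (auto simp: size_event_def indicator_def)
    finally show ?thesis .
  qed
  have f_i: "(\<lambda>y. f y $ i) \<in> borel_measurable state_space" for i
    using f by (rule measurable_vec_component)
  have f_i_le: "\<bar>f y $ i\<bar> \<le> B" if "y \<in> space state_space" for y i
    using component_le_norm_cart[of "f y" i] bound[OF that] by simp
  \<comment> \<open>The information carried by \<open>f\<close> of the state before the event.
    Measurability of \<open>f\<close> makes it a sub-sigma-algebra of \<open>Q\<close>, and only
    then does the defining property of conditional expectation become available.\<close>
  let ?F = "vimage_algebra (space Q) (\<lambda>(y, z). f y) (borel :: (real^'d) measure)"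
  have "subalgebra Q ?F"
    unfolding subalgebra_def
  proof
    have "(\<lambda>(y, z). f y) \<in> Q \<rightarrow>\<^sub>M borel"
      using measurable_compose[OF measurable_fst f, of state_space] sets_Q
      by (simp add: split_beta' cong: measurable_cong_sets)
    then show "sets ?F \<subseteq> sets Q"
      by (auto simp: sets_vimage_algebra2 intro: measurable_sets)
  qed simp
  then interpret F: finite_measure_subalgebra Q ?F
    by unfold_locales
  let ?after = "\<lambda>p. f (snd p) $ i"
  have after: "?after \<in> borel_measurable ?SS" "\<And>p. p \<in> space ?SS \<Longrightarrow> \<bar>?after p\<bar> \<le> B"
    using f_i_le by (auto intro: measurable_compose[OF measurable_snd f_i] simp: space_pair_measure)
  have int_after: "integrable Q ?after"
  proof (rule Q.integrable_const_bound)
    show "AE p in Q. norm (?after p) \<le> B"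
      using after(2) space_Q by (intro AE_I2) simp
    show "?after \<in> borel_measurable Q"
      using after(1) sets_Q by (simp cong: measurable_cong_sets)
  qed
  let ?before = "\<lambda>y. (A *v f y + b) $ i"
  have before_meas: "?before \<in> borel_measurable state_space"
    unfolding matrix_vector_mult_def vector_add_component vec_lambda_beta
    using f_i by (intro borel_measurable_add borel_measurable_sum borel_measurable_times) auto
  have "partial_mean (kernel_mean (\<lambda>y. f y $ i) e) (src e) s = ?\<pi> * (\<integral>y. kernel_mean (\<lambda>y. f y $ i) e y \<partial>D)"
    by (rule integral_D[symmetric, OF measurable_kernel_mean[OF e f_i]])
  also have "(\<integral>y. kernel_mean (\<lambda>y. f y $ i) e y \<partial>D) = (\<integral>p. ?after p \<partial>Q)"
    using integral_Q[OF after] by (simp add: kernel_mean_def)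
  also have "\<dots> = (\<integral>p. real_cond_exp Q ?F ?after p \<partial>Q)"
    by (rule F.real_cond_exp_int(2)[OF int_after, symmetric])
  also have "\<dots> = (\<integral>p. ?before (fst p) \<partial>Q)"
  proof (rule integral_cong_AE)
    have "AE p in Q. event_cond_exp M S src K f e s p = A *v f (fst p) + b"
      unfolding Q_def by (rule affine[OF pos])
    then show "AE p in Q. real_cond_exp Q ?F ?after p = ?before (fst p)"
    proof eventually_elim
      case (elim p)
      have "real_cond_exp Q ?F ?after p = event_cond_exp M S src K f e s p $ i"
        by (simp add: event_cond_exp_def vec_cond_exp_def Q_def split_beta')
      then show ?case by (simp add: elim)
    qed
    show "(\<lambda>p. ?before (fst p)) \<in> borel_measurable Q"
      using measurable_compose[OF measurable_fst before_meas] sets_Q by (simp cong: measurable_cong_sets)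
  qed (rule borel_measurable_cond_exp2)
  also have "\<dots> = (\<integral>y. ?before y \<partial>D)"
  proof -
    obtain C where C: "\<And>y. y \<in> space state_space \<Longrightarrow> \<bar>?before y\<bar> \<le> C"
    proof
      fix y assume y: "y \<in> space state_space"
      have "(\<Sum>j\<in>UNIV. \<bar>A $ i $ j * f y $ j\<bar>) \<le> (\<Sum>j\<in>UNIV. \<bar>A $ i $ j\<bar> * B)"
        using f_i_le[OF y] by (intro sum_mono) (auto simp: abs_mult intro!: mult_left_mono)
      moreover have "\<bar>\<Sum>j\<in>UNIV. A $ i $ j * f y $ j\<bar> \<le> (\<Sum>j\<in>UNIV. \<bar>A $ i $ j * f y $ j\<bar>)"
        by (rule sum_abs)
      ultimately have "\<bar>\<Sum>j\<in>UNIV. A $ i $ j * f y $ j\<bar> \<le> (\<Sum>j\<in>UNIV. \<bar>A $ i $ j\<bar> * B)"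
        by linarith
      then show "\<bar>?before y\<bar> \<le> (\<Sum>j\<in>UNIV. \<bar>A $ i $ j\<bar> * B) + \<bar>b $ i\<bar>"
        unfolding matrix_vector_mult_def vector_add_component vec_lambda_beta by linarith
    qed
    have "(\<integral>p. ?before (fst p) \<partial>Q) = (\<integral>y. (\<integral>z. ?before (fst (y, z)) \<partial>K e y) \<partial>D)"
    proof (rule integral_Q)
      show "(\<lambda>p. ?before (fst p)) \<in> borel_measurable ?SS"
        by (rule measurable_compose[OF measurable_fst before_meas])
      show "\<bar>?before (fst p)\<bar> \<le> C" if "p \<in> space ?SS" for p
        using C that by (auto simp: space_pair_measure)
    qed
    also have "\<dots> = (\<integral>y. ?before y \<partial>D)"
    proof (rule Bochner_Integration.integral_cong[OF refl])
      fix y assume "y \<in> space D"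
      then interpret Ke: prob_space "K e y"
        using sets_eq_imp_space_eq[OF sets_D] by (intro prob_space_kernel[OF e]) simp
      show "(\<integral>z. ?before (fst (y, z)) \<partial>K e y) = ?before y"
        by (simp add: Ke.prob_space)
    qed
    finally show ?thesis .
  qed
  \<comment> \<open>An affine map commutes with the mean under a probability measure; the total mass
    1 of \<open>D\<close> is what leaves \<open>b\<close> unscaled.\<close>
  also have "\<dots> = (A *v cond_mean M S f (src e) s + b) $ i"
  proof -
    have int_f: "integrable D f"
    proof (rule D.integrable_const_bound)
      show "AE y in D. norm (f y) \<le> B"
        using bound sets_eq_imp_space_eq[OF sets_D] by (intro AE_I2) simp
      show "f \<in> borel_measurable D"
        using f sets_D by (simp cong: measurable_cong_sets)
    qed
    have A_i: "bounded_linear (\<lambda>x. (A *v x) $ i)"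
      by (rule bounded_linear_compose[OF bounded_linear_vec_nth matrix_vector_mul_bounded_linear])
    have "(\<integral>y. ?before y \<partial>D) = (\<integral>y. (A *v f y) $ i \<partial>D) + b $ i"
      using integrable_bounded_linear[OF A_i int_f] by (simp add: D.prob_space)
    also have "(\<integral>y. (A *v f y) $ i \<partial>D) = (A *v (\<integral>y. f y \<partial>D)) $ i"
      by (rule integral_bounded_linear[OF A_i int_f])
    also have "(\<integral>y. f y \<partial>D) = cond_mean M S f (src e) s"
      using integral_distr[OF S_N f] by (simp only: D_def cond_mean_def N_def)
    finally show ?thesis by simp
  qed
  finally show ?thesis by simp
qed

end

text \<open>Summability is part of the conclusion because \<open>infsum\<close> defaults to 0 for
  families that are not summable. The derivative is taken within \<open>{0..}\<close> since the
  process starts at time 0, where it is one-sided.\<close>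

theorem proposition1:
  fixes M :: "'w measure" and \<Xi> :: "'c set"
    and rate :: "'c \<Rightarrow> real" and src arr :: "'c \<Rightarrow> nat"
    and K :: "'c \<Rightarrow> state \<Rightarrow> state measure"
    and J :: "nat \<Rightarrow> 'w \<Rightarrow> ereal" and Y :: "nat \<Rightarrow> 'w \<Rightarrow> state"
    and S :: "real \<Rightarrow> 'w \<Rightarrow> state"
    and f :: "state \<Rightarrow> real^'d"
    and A :: "'c \<Rightarrow> real^'d^'d" and b :: "'c \<Rightarrow> real^'d"
    and j :: nat and t :: real
  assumes process: "clock_jump_process M \<Xi> rate src arr K J Y S"
    and f_measurable: "f \<in> state_space \<rightarrow>\<^sub>M borel"
    and f_bounded: "bounded (f ` space state_space)"
    and affine: "\<And>\<epsilon> u. \<epsilon> \<in> \<Xi> \<Longrightarrow> 0 \<le> u \<Longrightarrow> 0 < size_prob M S (src \<epsilon>) u \<Longrightarrow>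
      AE p in event_law M S src K \<epsilon> u.
        event_cond_exp M S src K f \<epsilon> u p = A \<epsilon> *v f (fst p) + b \<epsilon>"
    and t_nonneg: "0 \<le> t"
    and regular: "inflow_converges M S \<Xi> rate src arr j t"
  shows "(\<lambda>\<epsilon>. (rate \<epsilon> * size_prob M S (src \<epsilon>) t) *\<^sub>R
             (A \<epsilon> *v cond_mean M S f (src \<epsilon>) t + b \<epsilon>))
           summable_on {\<epsilon> \<in> \<Xi>. arr \<epsilon> = j}
       \<and> ((\<lambda>u. size_prob M S j u *\<^sub>R cond_mean M S f j u) has_vector_derivative
           (\<Sum>\<^sub>\<infinity>\<epsilon>\<in>{\<epsilon> \<in> \<Xi>. arr \<epsilon> = j}. (rate \<epsilon> * size_prob M S (src \<epsilon>) t) *\<^sub>R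
              (A \<epsilon> *v cond_mean M S f (src \<epsilon>) t + b \<epsilon>))
           - (\<Sum>\<epsilon>\<in>{\<epsilon> \<in> \<Xi>. src \<epsilon> = j}. (rate \<epsilon> * size_prob M S j t) *\<^sub>R cond_mean M S f j t))
         (at t within {0..})"
proof -
  interpret clock_jump_process M \<Xi> rate src arr K J Y S by (rule process)
  let ?A = "{\<epsilon> \<in> \<Xi>. arr \<epsilon> = j}"
  let ?v = "\<lambda>\<epsilon>. (rate \<epsilon> * size_prob M S (src \<epsilon>) t) *\<^sub>R (A \<epsilon> *v cond_mean M S f (src \<epsilon>) t + b \<epsilon>)"
  let ?F = "\<lambda>u. size_prob M S j u *\<^sub>R cond_mean M S f j u"
  obtain B where B: "0 < B" and bound: "\<And>y. y \<in> space state_space \<Longrightarrow> norm (f y) \<le> B"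
    using f_bounded by (auto simp: bounded_pos)
  have f_i: "(\<lambda>y. f y $ i) \<in> borel_measurable state_space" for i
    using f_measurable by (rule measurable_vec_component)
  have f_i_le: "\<bar>f y $ i\<bar> \<le> B" if "y \<in> space state_space" for y i
    using component_le_norm_cart[of "f y" i] bound[OF that] by simp
  note deriv = partial_mean_has_derivative[OF f_i f_i_le B t_nonneg regular]
  have v_i: "?v \<epsilon> $ i = rate \<epsilon> * partial_mean (kernel_mean (\<lambda>y. f y $ i) \<epsilon>) (src \<epsilon>) t"
    if "\<epsilon> \<in> ?A" for \<epsilon> i
    using partial_mean_kernel_mean[OF _ t_nonneg f_measurable bound affine[OF _ t_nonneg], of \<epsilon> i] that
    by (simp add: mult.assoc)
  have F_i: "?F u $ i = partial_mean (\<lambda>y. f y $ i) j u" if "0 \<le> u" for u i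
    using that f_measurable bound by (rule size_prob_times_cond_mean)
  \<comment> \<open>The inflow is assembled from its components, because differentiation was done
    for scalar functions; \<open>has_sum_vec\<close> recovers convergence of the vector
    series.\<close>
  define w where "w = (\<chi> i. \<Sum>\<^sub>\<infinity>\<epsilon>\<in>?A. rate \<epsilon> * partial_mean (kernel_mean (\<lambda>y. f y $ i) \<epsilon>) (src \<epsilon>) t)"
  have sum: "(?v has_sum w) ?A"
  proof (rule has_sum_vec)
    fix i
    show "((\<lambda>\<epsilon>. ?v \<epsilon> $ i) has_sum w $ i) ?A"
      using has_sum_infsum[OF deriv(1)[of i]] unfolding w_def vec_lambda_beta
      by (subst has_sum_cong[OF v_i])
  qed
  \<comment> \<open>All clocks leaving size \<open>j\<close> multiply the same vector, so only the
    sum of their rates matters.\<close>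
  have out: "(\<Sum>\<epsilon>\<in>{\<epsilon> \<in> \<Xi>. src \<epsilon> = j}. (rate \<epsilon> * size_prob M S j t) *\<^sub>R cond_mean M S f j t) =
      total_rate j *\<^sub>R ?F t"
    by (simp add: total_rate_def clocks_def sum_distrib_right scaleR_sum_left)
  have "(?F has_vector_derivative w - total_rate j *\<^sub>R ?F t) (at t within {0..})"
  proof (rule has_vector_derivative_vec)
    fix i
    have "(w - total_rate j *\<^sub>R ?F t) $ i = w $ i - total_rate j * (?F t $ i)"
      by simp
    also have "\<dots> = (\<Sum>\<^sub>\<infinity>\<epsilon>\<in>?A. rate \<epsilon> * partial_mean (kernel_mean (\<lambda>y. f y $ i) \<epsilon>) (src \<epsilon>) t) -
        total_rate j * partial_mean (\<lambda>y. f y $ i) j t"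
      unfolding F_i[OF t_nonneg] w_def vec_lambda_beta ..
    finally have "(partial_mean (\<lambda>y. f y $ i) j has_real_derivative (w - total_rate j *\<^sub>R ?F t) $ i) (at t within {0..})"
      using deriv(2)[of i] by simp
    then show "((\<lambda>u. ?F u $ i) has_real_derivative (w - total_rate j *\<^sub>R ?F t) $ i) (at t within {0..})"
      by (rule has_real_derivative_transform_on) (use t_nonneg F_i in auto)
  qed
  then show ?thesis
    using has_sum_imp_summable[OF sum] infsumI[OF sum] out by simp
qed

end
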